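(* Let $\mathcal{M},\tilde{\mathcal{M}}\subset\mathbb{R}^2$ be $C^2_+$ bodies with support functions $h,\tilde h$, whose Fourier coefficients are $c_n,\tilde c_n$ ($n\in\mathbb{Z}$) respectively. Then $Ex(\cdot,\mathcal{M})=Ex(\cdot,\tilde{\mathcal{M}})$ if and only if $|c_n|=|\tilde c_n|$ for all $n\in\mathbb{Z}$ with $n\neq\pm1$. In particular, given a $C^2_+$ body $\mathcal{M}$ with Fourier coefficients $c_n$, there exists a convex body $\tilde{\mathcal{M}}$ which is not the image of $\mathcal{M}$ under a rigid motion and which satisfies $Ex(\cdot,\mathcal{M})=Ex(\cdot,\tilde{\mathcal{M}})$ if and only if the support function of $\mathcal{M}$ has at least two non-zero Fourier coefficients other than the constant and first order ones, i.e. there are integers $n_1>n_2\geq 2$ with $c_{n_1}\neq0$ and $c_{n_2}\neq 0$.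
   Context: A convex body is a non-empty compact convex subset of $\mathbb{R}^2$. Its support function is $h(\theta,\mathcal{M})=\max_{x\in\mathcal{M}}u_\theta\cdot x$, where $u_\theta=(\cos\theta,\sin\theta)$, with Fourier coefficients $c_n=\frac{1}{2\pi}\int_{-\pi}^{\pi}h(\theta,\mathcal{M})e^{-in\theta}\,d\theta$. A $C^2_+$ body is a strictly convex body with $C^2$ boundary and non-vanishing curvature; equivalently, $h(\cdot,\mathcal{M})$ is $C^2$ and $h+h''>0$. The excluded area function is $Ex(\theta,\mathcal{M})=|\mathcal{M}-R_\theta\mathcal{M}|$, where $R_\theta$ is the counterclockwise rotation by angle $\theta$, $A-B=\{a-b:a\in A,b\in B\}$, and $|\cdot|$ is Lebesgue measure (area). A rigid motion is a composition of a rotation in $\mathrm{SO}(2)$ and a translation. *)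

theory Defs
  imports "HOL-Analysis.Analysis"
begin

definition convex_body :: "(real^2) set \<Rightarrow> bool" where
  "convex_body M \<longleftrightarrow> M \<noteq> {} \<and> compact M \<and> convex M"

definition unit_dir :: "real \<Rightarrow> real^2" where
  "unit_dir \<theta> = vector [cos \<theta>, sin \<theta>]"

text \<open>For a convex body the supremum is a maximum, by compactness.\<close>

definition support_fun :: "(real^2) set \<Rightarrow> real \<Rightarrow> real" where
  "support_fun M \<theta> = (SUP x\<in>M. unit_dir \<theta> \<bullet> x)"

definition fourier_coeff :: "(real \<Rightarrow> real) \<Rightarrow> int \<Rightarrow> complex" where
  "fourier_coeff f n =
     1 / (2 * of_real pi) *
       integral {-pi..pi} (\<lambda>\<theta>. of_real (f \<theta>) * exp (- \<i> * of_int n * of_real \<theta>))"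

definition strictly_convex :: "(real^2) set \<Rightarrow> bool" where
  "strictly_convex M \<longleftrightarrow> (\<forall>x\<in>M. \<forall>y\<in>M. open_segment x y \<subseteq> interior M)"

text \<open>Signed curvature of a plane curve with velocity \<open>v\<close> and acceleration \<open>a\<close>.\<close>

definition curvature :: "real^2 \<Rightarrow> real^2 \<Rightarrow> real" where
  "curvature v a = (v$1 * a$2 - v$2 * a$1) / norm v ^ 3"

text \<open>
  \<open>M\<close> has \<open>C\<^sup>2\<close> boundary with non-vanishing curvature: the boundary is the trace of a regular
  simple closed curve of class \<open>C\<^sup>2\<close>. The curve \<open>g\<close> is a 1-periodic function on the whole line,
  so that it is also \<open>C\<^sup>2\<close> at the base point; \<open>g1\<close> and \<open>g2\<close> are its first two derivatives.
\<close>

definition C2_boundary_nonvanishing_curvature :: "(real^2) set \<Rightarrow> bool" where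
  "C2_boundary_nonvanishing_curvature M \<longleftrightarrow>
     (\<exists>g g1 g2 :: real \<Rightarrow> real^2.
        (\<forall>t. (g has_vector_derivative g1 t) (at t)) \<and>
        (\<forall>t. (g1 has_vector_derivative g2 t) (at t)) \<and>
        continuous_on UNIV g2 \<and>
        (\<forall>t. g (t + 1) = g t) \<and>
        simple_path g \<and>
        path_image g = frontier M \<and>
        (\<forall>t. g1 t \<noteq> 0) \<and>
        (\<forall>t. curvature (g1 t) (g2 t) \<noteq> 0))"

definition C2_plus_body :: "(real^2) set \<Rightarrow> bool" where
  "C2_plus_body M \<longleftrightarrow>
     convex_body M \<and> strictly_convex M \<and> C2_boundary_nonvanishing_curvature M"

definition rot :: "real \<Rightarrow> real^2^2" where
  "rot \<theta> = vector [vector [cos \<theta>, - sin \<theta>], vector [sin \<theta>, cos \<theta>]]"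

definition excluded_area :: "(real^2) set \<Rightarrow> real \<Rightarrow> real" where
  "excluded_area M \<theta> = measure lebesgue {a - b | a b. a \<in> M \<and> b \<in> (\<lambda>x. rot \<theta> *v x) ` M}"

text \<open>The predicate \<^const>\<open>rotation_matrix\<close> means orthogonal with determinant 1.\<close>

definition rigid_motion :: "(real^2 \<Rightarrow> real^2) \<Rightarrow> bool" where
  "rigid_motion f \<longleftrightarrow>
     (\<exists>(Q :: real^2^2) b. rotation_matrix Q \<and> f = (\<lambda>x. Q *v x + b))"

end

theory Submission
  imports Defs "HOL-Real_Asymp.Real_Asymp" "HOL-Library.Periodic_Fun"
begin

text \<open>
  Write \<open>h\<close> for the support function of \<open>M\<close>, so that \<open>M - R\<^sub>\<theta> M\<close> has support function
  \<open>h(t) + h(t - \<theta> + \<pi>)\<close>. A convex body with smooth support function \<open>p\<close> has area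
  \<open>1/2 \<integral> p (p + p'')\<close>. Convolution with the Fejer kernel preserves the inequality
  \<open>h(t + d) + h(t - d) \<ge> 2 cos d h(t)\<close>, which characterises support functions, so the Fejer means of \<open>h\<close> are
  support functions of smooth bodies, for which the area is a finite Fourier sum. Hence \<open>Ex(\<theta>)\<close> is the uniform
  limit of the Fejer-weighted sums
  \<open>\<pi> \<Sum> (1 - n\<^sup>2) |c\<^sub>n|\<^sup>2 (2 + 2 cos n(\<theta> - \<pi>))\<close>, and its cosine coefficients give back the \<open>|c\<^sub>n|\<close>
  with \<open>n \<noteq> \<plusminus>1\<close>.

  If only one coefficient with \<open>n \<ge> 2\<close> is non-zero, a rotation and a translation match all phases. If there are
  two, rotating the phase of one of them by a small angle keeps \<open>h + h'' > 0\<close> and yields a body that no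
  rotation brings back.
\<close>

section \<open>Support functions\<close>

text \<open>The bodies are given by a C2 boundary curve, and the second body of the last claim is an
  arbitrary convex body, so derivatives of a support function are not at hand. This is why the
  second-difference inequality carries the argument. Convergence of the areas comes from inclusion:
  the smoothed body lies between \<open>rot_difference M \<theta>\<close> and a slightly enlarged
  homothetic copy of it, which needs a disc around the origin inside \<open>M\<close>; bodies
  without interior are told apart by the excluded area at angle 0. The factor 1 - n^2 hides n = 1
  and n = -1, which are exactly the coefficients that a translation changes. The constant
  coefficient is not isolated by a cosine integral; it is compared through the value at \<theta> = 0
  once all others agree. Its modulus determines it because it is a nonnegative real number, half the
  mean width. For the twin body, a lower bound for the second difference of \<open>h\<close> that is
  quadratic in d takes the place of h + h'' > 0.\<close>

lemma inner_unit_dir: "unit_dir t \<bullet> x = cos t * x$1 + sin t * x$2"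
  by (simp add: unit_dir_def inner_vec_def sum_2)

lemma unit_dir_nth [simp]: "unit_dir t $ 1 = cos t" "unit_dir t $ 2 = sin t"
  by (simp_all add: unit_dir_def)

lemma norm_unit_dir [simp]: "norm (unit_dir t) = 1"
  by (simp add: norm_vec_def L2_set_def sum_2)

lemma unit_dir_periodic [simp]: "unit_dir (t + 2 * pi) = unit_dir t"
  by (simp add: unit_dir_def)

lemma unit_dir_add:
  "unit_dir (t + s) = cos s *\<^sub>R unit_dir t + sin s *\<^sub>R unit_dir (t + pi/2)"
  by (simp add: vec_eq_iff forall_2 cos_add sin_add algebra_simps)

lemma unit_dir_add_pi: "unit_dir (t + pi) = - unit_dir t"
  by (simp add: vec_eq_iff forall_2)

lemma unit_dir_second_difference:
  "unit_dir (t + d) + unit_dir (t - d) = (2 * cos d) *\<^sub>R unit_dir t"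
  by (simp add: vec_eq_iff forall_2 cos_add sin_add cos_diff sin_diff algebra_simps)

lemma vec2_polar: "\<exists>t. x = norm x *\<^sub>R unit_dir t" for x :: "real^2"
proof (cases "x = 0")
  case False
  have n: "norm x \<noteq> 0" "(norm x)^2 = (x$1)^2 + (x$2)^2"
    by (simp add: False) (simp add: norm_vec_def L2_set_def sum_2)
  have "(x$1 / norm x)^2 + (x$2 / norm x)^2 = 1"
    by (simp only: power_divide flip: add_divide_distrib n(2)) (simp add: False)
  then obtain t where t: "x$1 / norm x = cos t" "x$2 / norm x = sin t"
    using sincos_total_2pi by metis
  have "x = norm x *\<^sub>R unit_dir t"
    unfolding vec_eq_iff forall_2 vector_scaleR_component unit_dir_nth t[symmetric]
    using n(1) by simp
  then show ?thesis ..
qed auto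

text \<open>Chords of the unit circle are written as \<open>cmod (1 - cis x)\<close> because
  \<open>fejer_kernel_decay\<close> bounds the kernel against the square of this quantity; Lipschitz
  estimates for support functions then combine with it directly.\<close>

lemma norm_unit_dir_diff: "norm (unit_dir s - unit_dir t) = cmod (1 - cis (t - s))"
proof -
  have "(norm (unit_dir s - unit_dir t))\<^sup>2 = (cmod (1 - cis (t - s)))\<^sup>2"
    by (simp add: norm_vec_def L2_set_def sum_2 cmod_power2 cos_diff sin_diff)
       (simp add: power2_eq_square algebra_simps,
        use sin_cos_squared_add[of s] sin_cos_squared_add[of t] in algebra)
  then show ?thesis by (simp add: power2_eq_iff_nonneg)
qed

lemma continuous_on_unit_dir [continuous_intros]:
  fixes S :: "'a :: t2_space set"
  assumes "continuous_on S f"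
  shows "continuous_on S (\<lambda>x. unit_dir (f x))"
proof -
  have "unit_dir t = cos t *\<^sub>R axis 1 1 + sin t *\<^sub>R axis 2 1" for t
    by (simp add: vec_eq_iff forall_2 axis_def)
  then show ?thesis
    using assms by (auto intro!: continuous_intros)
qed

lemma angle_reduction:
  obtains r k where "\<bar>r\<bar> \<le> pi" "s = t + r + of_int k * (2 * pi)"
proof -
  define k where "k = \<lfloor>(s - t + pi) / (2 * pi)\<rfloor>"
  define r where "r = s - t - of_int k * (2 * pi)"
  have "of_int k \<le> (s - t + pi) / (2 * pi)" "(s - t + pi) / (2 * pi) < of_int k + 1"
    unfolding k_def by linarith+
  then have "\<bar>r\<bar> \<le> pi"
    by (simp add: r_def field_simps abs_le_iff)
  then show thesis by (rule that) (simp add: r_def)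
qed

lemma convex_body_bdd_above: "convex_body M \<Longrightarrow> bdd_above ((\<lambda>x. v \<bullet> x) ` M)"
  unfolding convex_body_def
  by (intro bounded_imp_bdd_above compact_imp_bounded compact_continuous_image continuous_intros) auto

lemma support_fun_upper: "convex_body M \<Longrightarrow> x \<in> M \<Longrightarrow> unit_dir t \<bullet> x \<le> support_fun M t"
  unfolding support_fun_def by (rule cSUP_upper) (auto intro: convex_body_bdd_above)

lemma support_fun_attained:
  assumes "convex_body M"
  obtains x where "x \<in> M" "support_fun M t = unit_dir t \<bullet> x"
proof -
  have "\<exists>x\<in>M. \<forall>y\<in>M. unit_dir t \<bullet> y \<le> unit_dir t \<bullet> x"
    using assms unfolding convex_body_def
    by (intro continuous_attains_sup continuous_intros) auto
  then obtain x where "x \<in> M" "\<forall>y\<in>M. unit_dir t \<bullet> y \<le> unit_dir t \<bullet> x" by blast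
  then have "support_fun M t = unit_dir t \<bullet> x"
    unfolding support_fun_def by (intro cSup_eq_maximum) auto
  with \<open>x \<in> M\<close> that show thesis by blast
qed

lemma support_fun_eqI:
  assumes "x \<in> M" "unit_dir t \<bullet> x = s" "\<And>y. y \<in> M \<Longrightarrow> unit_dir t \<bullet> y \<le> s"
  shows "support_fun M t = s"
  unfolding support_fun_def using assms by (intro cSup_eq_maximum) auto

lemma support_fun_periodic [simp]: "support_fun M (t + 2 * pi) = support_fun M t"
  by (simp add: support_fun_def)

text \<open>The Wulff shape of \<open>f\<close>. Nothing here forces \<open>f\<close> to be its
  support function, which is smaller wherever a constraint is slack;
  \<open>support_fun_wulff\<close> gives conditions for equality.\<close>

definition wulff :: "(real \<Rightarrow> real) \<Rightarrow> (real^2) set" where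
  "wulff f = {x. \<forall>t. unit_dir t \<bullet> x \<le> f t}"

lemma wulff_mono: "(\<And>t. f t \<le> g t) \<Longrightarrow> wulff f \<subseteq> wulff g"
  unfolding wulff_def by (auto intro: order_trans)

lemma wulff_scale:
  assumes "c > 0"
  shows "wulff (\<lambda>t. c * f t) = (\<lambda>x. c *\<^sub>R x) ` wulff f"
proof (intro set_eqI iffI)
  fix x assume "x \<in> wulff (\<lambda>t. c * f t)"
  then have "x = c *\<^sub>R (x /\<^sub>R c)" "x /\<^sub>R c \<in> wulff f"
    using assms by (auto simp: wulff_def field_simps)
  then show "x \<in> (\<lambda>x. c *\<^sub>R x) ` wulff f" by blast
qed (use assms in \<open>auto simp: wulff_def\<close>)

lemma convex_closed_wulff: "convex (wulff f)" "closed (wulff f)"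
proof -
  have eq: "wulff f = (\<Inter>t. {x. unit_dir t \<bullet> x \<le> f t})"
    by (auto simp: wulff_def)
  show "convex (wulff f)" "closed (wulff f)"
    unfolding eq by (auto intro!: convex_INT closed_INT convex_halfspace_le closed_halfspace_le)
qed

lemma compact_wulff:
  assumes "\<And>t. f t \<le> B"
  shows "compact (wulff f)"
proof -
  have "norm x \<le> B" if "x \<in> wulff f" for x
  proof -
    obtain t where t: "x = norm x *\<^sub>R unit_dir t" using vec2_polar by blast
    have "unit_dir t \<bullet> x = norm x"
      by (subst t) (simp add: dot_square_norm)
    moreover have "unit_dir t \<bullet> x \<le> f t" using that by (simp add: wulff_def)
    ultimately show ?thesis using assms[of t] by linarith
  qed
  then have "bounded (wulff f)" unfolding bounded_iff by blast
  then show ?thesis using convex_closed_wulff compact_eq_bounded_closed by blast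
qed

text \<open>A point outside \<open>M\<close> is strictly separated from it by a line, whose unit
  normal gives a violated constraint. The normal is taken from \<open>- a\<close> because the
  separation puts \<open>M\<close> on the side of larger values.\<close>

lemma convex_body_eq_wulff:
  assumes "convex_body M"
  shows "M = wulff (support_fun M)"
proof (intro equalityI subsetI)
  fix x assume x: "x \<in> wulff (support_fun M)"
  show "x \<in> M"
  proof (rule ccontr)
    assume "x \<notin> M"
    moreover have "convex M" "closed M"
      using assms by (auto simp: convex_body_def compact_imp_closed)
    ultimately obtain a b where ab: "a \<bullet> x < b" "\<forall>y\<in>M. a \<bullet> y > b"
      using separating_hyperplane_closed_point by blast
    obtain t where t: "- a = norm a *\<^sub>R unit_dir t" using vec2_polar[of "- a"] by auto
    obtain y where y: "y \<in> M" "support_fun M t = unit_dir t \<bullet> y"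
      using support_fun_attained assms by blast
    have "unit_dir t \<bullet> x \<le> unit_dir t \<bullet> y" using x by (simp add: wulff_def flip: y(2))
    then have "(- a) \<bullet> x \<le> (- a) \<bullet> y"
      by (subst (1 2) t) (simp add: mult_left_mono)
    moreover have "a \<bullet> x < a \<bullet> y" using ab y(1) by force
    ultimately show False by (simp add: inner_minus_left)
  qed
qed (use assms support_fun_upper in \<open>auto simp: wulff_def\<close>)

lemma support_fun_inj:
  assumes "convex_body M" "convex_body N" "support_fun M = support_fun N"
  shows "M = N"
  using assms convex_body_eq_wulff by metis

text \<open>A maximiser for direction s is a competitor for direction t, so the two values differ by
  at most the norm of that point times the chord between the directions.\<close>

lemma support_fun_diff_le:
  assumes "convex_body M" "\<And>x. x \<in> M \<Longrightarrow> norm x \<le> R"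
  shows "\<bar>support_fun M s - support_fun M t\<bar> \<le> R * cmod (1 - cis (t - s))"
proof -
  have *: "support_fun M s - support_fun M t \<le> R * norm (unit_dir s - unit_dir t)" for s t
  proof -
    obtain x where x: "x \<in> M" "support_fun M s = unit_dir s \<bullet> x"
      using support_fun_attained assms by blast
    have "support_fun M s - support_fun M t \<le> (unit_dir s - unit_dir t) \<bullet> x"
      using support_fun_upper[OF assms(1) x(1), of t] x by (simp add: inner_diff_left)
    also have "\<dots> \<le> norm (unit_dir s - unit_dir t) * norm x" by (rule norm_cauchy_schwarz)
    also have "\<dots> \<le> norm (unit_dir s - unit_dir t) * R"
      using assms(2)[OF x(1)] by (intro mult_left_mono) auto
    finally show ?thesis by (simp add: mult.commute)
  qed
  show ?thesis
    using *[of s t] *[of t s] by (simp add: norm_minus_commute abs_le_iff flip: norm_unit_dir_diff)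
qed

lemma convex_body_norm_bound:
  assumes "convex_body M"
  obtains R where "R > 0" "\<And>x. x \<in> M \<Longrightarrow> norm x \<le> R"
  using assms unfolding convex_body_def
  by (metis bounded_pos compact_imp_bounded)

lemma continuous_on_support_fun:
  assumes "convex_body M"
  shows "continuous_on S (support_fun M)"
proof -
  obtain R where R: "R > 0" "\<And>x. x \<in> M \<Longrightarrow> norm x \<le> R"
    using convex_body_norm_bound assms by blast
  have "isCont (support_fun M) t" for t
    unfolding isCont_def
  proof (rule Lim_transform_bound[where g = "\<lambda>s. R * cmod (1 - cis (t - s))", THEN Lim_null[THEN iffD2]])
    show "\<forall>\<^sub>F s in at t. norm (support_fun M s - support_fun M t) \<le> norm (R * cmod (1 - cis (t - s)))"
      using support_fun_diff_le[OF assms R(2)] R(1) by (auto intro!: always_eventually)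
    have "isCont (\<lambda>s. R * cmod (1 - cis (t - s))) t"
      unfolding cis_conv_exp by (intro continuous_intros)
    then show "((\<lambda>s. R * cmod (1 - cis (t - s))) \<longlongrightarrow> 0) (at t)"
      by (simp add: isCont_def)
  qed
  then show ?thesis by (simp add: continuous_at_imp_continuous_on)
qed

text \<open>A point of contact for direction \<open>t\<close> is a competitor for
  \<open>t + d\<close> and \<open>t - d\<close>, and the sum of these two directions is 2 cos d
  times direction \<open>t\<close>.\<close>

lemma support_fun_second_difference:
  assumes "convex_body M"
  shows "support_fun M (t + d) + support_fun M (t - d) \<ge> 2 * cos d * support_fun M t"
proof -
  obtain x where x: "x \<in> M" "support_fun M t = unit_dir t \<bullet> x"
    using support_fun_attained assms by blast
  have "2 * cos d * support_fun M t = unit_dir (t + d) \<bullet> x + unit_dir (t - d) \<bullet> x"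
    by (simp add: x unit_dir_second_difference flip: inner_add_left)
  then show ?thesis using support_fun_upper[OF assms x(1)] by (metis add_mono)
qed

section \<open>Rotations, translations and the difference of a body and its rotated copy\<close>

lemma rot_nth: "(rot \<alpha> *v x) $ 1 = cos \<alpha> * x$1 - sin \<alpha> * x$2"
    "(rot \<alpha> *v x) $ 2 = sin \<alpha> * x$1 + cos \<alpha> * x$2"
  by (simp_all add: rot_def matrix_vector_mult_def sum_2)

lemma unit_dir_inner_rot: "unit_dir t \<bullet> (rot \<alpha> *v x) = unit_dir (t - \<alpha>) \<bullet> x"
  by (simp add: inner_unit_dir rot_nth cos_diff sin_diff algebra_simps)

lemma convex_body_affine_image:
  assumes "convex_body M"
  shows "convex_body ((\<lambda>x. rot \<alpha> *v x + b) ` M)"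
proof -
  have "(\<lambda>x. rot \<alpha> *v x + b) ` M = (+) b ` (*v) (rot \<alpha>) ` M"
    by (auto simp: image_image add.commute)
  moreover have "compact ((+) b ` (*v) (rot \<alpha>) ` M)"
    using assms unfolding convex_body_def
    by (intro compact_translation compact_continuous_image matrix_vector_mult_linear_continuous_on) auto
  moreover have "convex ((+) b ` (*v) (rot \<alpha>) ` M)"
    using assms unfolding convex_body_def
    by (intro convex_translation convex_linear_image) auto
  ultimately show ?thesis
    using assms unfolding convex_body_def by auto
qed

lemma support_fun_affine_image:
  assumes "convex_body M"
  shows "support_fun ((\<lambda>x. rot \<alpha> *v x + b) ` M) t = support_fun M (t - \<alpha>) + unit_dir t \<bullet> b"
proof -
  obtain x where x: "x \<in> M" "support_fun M (t - \<alpha>) = unit_dir (t - \<alpha>) \<bullet> x"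
    using support_fun_attained assms by blast
  show ?thesis
    using x support_fun_upper[OF assms, of _ "t - \<alpha>"]
    by (intro support_fun_eqI[of "rot \<alpha> *v x + b"]) (auto simp: inner_add_right unit_dir_inner_rot)
qed

definition rot_difference :: "(real^2) set \<Rightarrow> real \<Rightarrow> (real^2) set" where
  "rot_difference M \<theta> = {a - b |a b. a \<in> M \<and> b \<in> (\<lambda>x. rot \<theta> *v x) ` M}"

lemma rot_difference_alt: "rot_difference M \<theta> = {a - rot \<theta> *v b |a b. a \<in> M \<and> b \<in> M}"
  unfolding rot_difference_def by blast

lemma excluded_area_eq: "excluded_area M \<theta> = measure lebesgue (rot_difference M \<theta>)"
  by (simp add: excluded_area_def rot_difference_def)

lemma convex_body_rot_difference:
  assumes "convex_body M"
  shows "convex_body (rot_difference M \<theta>)"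
proof -
  define N where "N = (\<lambda>x. rot \<theta> *v x) ` M"
  have "convex_body N"
    unfolding N_def using convex_body_affine_image[OF assms, of \<theta> 0] by simp
  then have "convex (\<Union>x\<in>M. \<Union>y\<in>N. {x - y})" "compact {x - y |x y. x \<in> M \<and> y \<in> N}" "N \<noteq> {}"
    using assms unfolding convex_body_def by (blast intro: convex_differences compact_differences)+
  moreover have "(\<Union>x\<in>M. \<Union>y\<in>N. {x - y}) = rot_difference M \<theta>"
    unfolding rot_difference_def N_def by blast
  moreover have "{x - y |x y. x \<in> M \<and> y \<in> N} = rot_difference M \<theta>"
    unfolding rot_difference_def N_def by blast
  ultimately show ?thesis
    using assms unfolding convex_body_def by auto
qed

lemma support_fun_rot_difference:
  assumes "convex_body M"
  shows "support_fun (rot_difference M \<theta>) t = support_fun M t + support_fun M (t - \<theta> + pi)"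
proof -
  obtain x where x: "x \<in> M" "support_fun M t = unit_dir t \<bullet> x"
    using support_fun_attained assms by blast
  obtain y where y: "y \<in> M" "support_fun M (t - \<theta> + pi) = unit_dir (t - \<theta> + pi) \<bullet> y"
    using support_fun_attained assms by blast
  have *: "unit_dir t \<bullet> (a - rot \<theta> *v b) = unit_dir t \<bullet> a + unit_dir (t - \<theta> + pi) \<bullet> b" for a b
    by (simp add: inner_diff_right unit_dir_inner_rot unit_dir_add_pi)
  show ?thesis
  proof (rule support_fun_eqI[of "x - rot \<theta> *v y"])
    show "x - rot \<theta> *v y \<in> rot_difference M \<theta>"
      using x y by (auto simp: rot_difference_alt)
    show "unit_dir t \<bullet> z \<le> support_fun M t + support_fun M (t - \<theta> + pi)"
      if "z \<in> rot_difference M \<theta>" for z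
      using that support_fun_upper[OF assms] by (auto simp: rot_difference_alt * intro!: add_mono)
  qed (simp add: * x y)
qed

text \<open>Moving \<open>M\<close> by \<open>c\<close> moves the whole difference set by
  \<open>c - rot \<theta> *v c\<close>. This allows an interior point to be placed at the
  origin.\<close>

lemma excluded_area_translate: "excluded_area ((+) c ` M) = excluded_area M"
proof
  fix \<theta>
  have *: "(c + a) - rot \<theta> *v (c + b) = (c - rot \<theta> *v c) + (a - rot \<theta> *v b)" for a b
    by (simp add: matrix_vector_right_distrib)
  have "rot_difference ((+) c ` M) \<theta> = {(c + a) - rot \<theta> *v (c + b) |a b. a \<in> M \<and> b \<in> M}"
    unfolding rot_difference_alt by blast
  also have "\<dots> = (+) (c - rot \<theta> *v c) ` rot_difference M \<theta>"
    unfolding rot_difference_alt * by blast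
  finally have "rot_difference ((+) c ` M) \<theta> = (+) (c - rot \<theta> *v c) ` rot_difference M \<theta>" .
  then show "excluded_area ((+) c ` M) \<theta> = excluded_area M \<theta>"
    by (simp only: excluded_area_eq measure_translation)
qed

section \<open>Fourier coefficients and Fejer means\<close>

text \<open>With an antiderivative \<open>g\<close> of \<open>f\<close>, the integral over a period
  is \<open>g (x + T) - g x\<close>, whose derivative in \<open>x\<close> is f(x + T) - f(x) = 0.
  The interval from \<open>c\<close> to \<open>d\<close> is chosen to contain both periods.\<close>

lemma periodic_integral_shift:
  fixes f :: "real \<Rightarrow> complex"
  assumes cont: "continuous_on UNIV f" and per: "\<And>t. f (t + T) = f t" and "T \<ge> 0"
  shows "integral {a..a + T} f = integral {b..b + T} f"
proof -
  define c where "c = min a b"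
  define d where "d = max a b + T"
  have "c \<le> d" using \<open>T \<ge> 0\<close> by (auto simp: c_def d_def)
  then obtain g where g: "\<And>x. x \<in> {c..d} \<Longrightarrow> (g has_vector_derivative f x) (at x within {c..d})"
    using antiderivative_continuous continuous_on_subset[OF cont] by (metis subset_UNIV)
  have I: "integral {x..x + T} f = g (x + T) - g x" if "x \<in> {min a b..max a b}" for x
    using that \<open>T \<ge> 0\<close>
    by (intro integral_unique fundamental_theorem_of_calculus)
       (auto simp: c_def d_def intro!: has_vector_derivative_within_subset[OF g])
  have der: "((\<lambda>x. g (x + T) - g x) has_vector_derivative 0) (at x within {min a b..max a b})"
    if x: "x \<in> {min a b..max a b}" for x
  proof -
    have "(g \<circ> (\<lambda>x. x + T) has_vector_derivative (1 *\<^sub>R f (x + T))) (at x within {min a b..max a b})"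
      using x \<open>T \<ge> 0\<close>
      by (intro vector_diff_chain_within)
         (auto simp: c_def d_def intro!: derivative_eq_intros has_vector_derivative_within_subset[OF g])
    moreover have "(g has_vector_derivative f x) (at x within {min a b..max a b})"
      using x \<open>T \<ge> 0\<close> by (intro has_vector_derivative_within_subset[OF g]) (auto simp: c_def d_def)
    ultimately show ?thesis
      using has_vector_derivative_diff by (fastforce simp: per o_def)
  qed
  obtain k where "\<And>x. x \<in> {min a b..max a b} \<Longrightarrow> g (x + T) - g x = k"
    using has_vector_derivative_zero_constant[OF convex_real_interval(5) der] by blast
  then show ?thesis using I[of a] I[of b] by auto
qed

lemma has_integral_cis:
  "((\<lambda>s. cis (of_int n * s)) has_integral (if n = 0 then of_real (2 * pi) else 0)) {a..a + 2 * pi}"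
proof (cases "n = 0")
  case True
  then show ?thesis
    using has_integral_const_real[of "1::complex" a "a + 2 * pi"] by (simp add: scaleR_conv_of_real)
next
  case False
  define F where "F z = exp (\<i> * of_int n * z) / (\<i> * of_int n)" for z :: complex
  have "((\<lambda>s. F (of_real s)) has_vector_derivative cis (of_int n * s)) (at s within A)" for s A
    using False unfolding F_def cis_conv_exp
    by (intro has_vector_derivative_real_field) (auto intro!: derivative_eq_intros simp: algebra_simps)
  then have "((\<lambda>s. cis (of_int n * s)) has_integral (F (of_real (a + 2 * pi)) - F (of_real a))) {a..a + 2 * pi}"
    by (intro fundamental_theorem_of_calculus) auto
  moreover have "F (of_real (a + 2 * pi)) = F (of_real a)"
  proof -
    have "exp (\<i> * of_int n * of_real (a + 2 * pi)) = cis (of_int n * a) * cis (2 * pi * of_int n)"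
      by (simp add: cis_conv_exp algebra_simps flip: exp_add)
    also have "cis (2 * pi * of_int n) = 1"
      by (rule cis_multiple_2pi) simp
    finally show ?thesis by (simp add: F_def cis_conv_exp algebra_simps)
  qed
  ultimately show ?thesis using False by simp
qed

lemma fourier_coeff_cis:
  "fourier_coeff f n = integral {-pi..pi} (\<lambda>s. of_real (f s) * cis (- (of_int n * s))) / (2 * of_real pi)"
  unfolding fourier_coeff_def cis_conv_exp by (simp add: mult.assoc)

lemma continuous_on_cis_mult [continuous_intros]:
  "continuous_on S f \<Longrightarrow> continuous_on S (\<lambda>x. cis (f x))" for f :: "real \<Rightarrow> real"
  unfolding cis_conv_exp by (intro continuous_intros)

lemma fourier_integrand_integrable:
  "continuous_on UNIV f \<Longrightarrow> (\<lambda>s. complex_of_real (f s) * cis (- (c * s))) integrable_on {a..b}"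
  by (intro integrable_continuous_interval continuous_intros)
     (auto intro: continuous_on_subset)

lemma fourier_coeff_add:
  assumes "continuous_on UNIV f" "continuous_on UNIV g"
  shows "fourier_coeff (\<lambda>t. f t + g t) n = fourier_coeff f n + fourier_coeff g n"
  unfolding fourier_coeff_cis of_real_add distrib_right
  by (subst integral_add) (auto simp: fourier_integrand_integrable assms add_divide_distrib)

lemma fourier_coeff_cmult:
  shows "fourier_coeff (\<lambda>t. c * f t) n = of_real c * fourier_coeff f n"
  unfolding fourier_coeff_cis by (simp add: mult.assoc)

lemma fourier_coeff_uminus: "fourier_coeff f (- n) = cnj (fourier_coeff f n)"
  unfolding fourier_coeff_cis by (simp add: integral_cnj cis_cnj)

lemma fourier_coeff_zero_real: "fourier_coeff f 0 = of_real (Re (fourier_coeff f 0))"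
  using fourier_coeff_uminus[of f 0] by (simp add: complex_eq_iff)

lemma fourier_coeff_shift:
  assumes cont: "continuous_on UNIV f" and per: "\<And>t. f (t + 2 * pi) = f t"
  shows "fourier_coeff (\<lambda>t. f (t + a)) n = cis (of_int n * a) * fourier_coeff f n"
proof -
  define g where "g t = complex_of_real (f t) * cis (- (of_int n * t))" for t
  have gc: "continuous_on UNIV g"
    unfolding g_def by (intro continuous_intros cont)
  have gper: "g (t + 2 * pi) = g t" for t
  proof -
    have "cis (- (of_int n * (t + 2 * pi))) = cis (- (of_int n * t)) * cis (2 * pi * of_int (- n))"
      by (simp add: cis_mult algebra_simps)
    also have "cis (2 * pi * of_int (- n)) = 1"
      by (rule cis_multiple_2pi) simp
    finally show ?thesis by (simp add: g_def per)
  qed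
  have "integral {-pi..pi} (\<lambda>s. of_real (f (s + a)) * cis (- (of_int n * s)))
      = integral {-pi..pi} (\<lambda>s. cis (of_int n * a) * g (s + a))"
    by (intro integral_cong) (simp add: g_def cis_mult algebra_simps)
  also have "\<dots> = cis (of_int n * a) * integral {-pi..pi} (g \<circ> (\<lambda>s. s + a))"
    by (simp add: o_def)
  also have "integral {-pi..pi} (g \<circ> (\<lambda>s. s + a)) = integral {-pi + a..(-pi + a) + 2 * pi} g"
    by (subst integral_shift) (auto intro: continuous_on_subset[OF gc])
  also have "\<dots> = integral {-pi..-pi + 2 * pi} g"
    by (intro periodic_integral_shift gc gper) auto
  also have "\<dots> = integral {-pi..pi} g" by simp
  finally show ?thesis
    unfolding fourier_coeff_cis g_def by simp
qed

text \<open>The two conditions are additive: for \<open>m = 0\<close> both apply, and the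
  coefficient is \<open>a + cnj a\<close>. The same formula serves linear functionals
  (\<open>m = 1\<close>), constants and the perturbation of the twin body.\<close>

lemma fourier_coeff_trig_monomial:
  "fourier_coeff (\<lambda>t. 2 * Re (a * cis (of_int m * t))) n =
     (if n = m then a else 0) + (if n = - m then cnj a else 0)"
proof -
  have 1: "complex_of_real (2 * Re (a * cis (of_int m * t))) * cis (- (of_int n * t))
      = a * cis (of_int (m - n) * t) + cnj a * cis (of_int (- m - n) * t)" for t
  proof -
    have "complex_of_real (2 * Re z) * w = z * w + cnj z * w" for z w
      by (simp add: complex_eq_iff algebra_simps)
    then show ?thesis
      by (simp only: complex_cnj_mult cis_cnj mult.assoc cis_mult) (simp add: algebra_simps)
  qed
  have "((\<lambda>t. a * cis (of_int (m - n) * t) + cnj a * cis (of_int (- m - n) * t)) has_integral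
      a * (if m - n = 0 then of_real (2 * pi) else 0) + cnj a * (if - m - n = 0 then of_real (2 * pi) else 0))
      {-pi..-pi + 2 * pi}"
    by (intro has_integral_add has_integral_mult_right has_integral_cis)
  then show ?thesis
    unfolding fourier_coeff_cis 1 by (auto dest!: integral_unique simp: add_divide_distrib)
qed

section \<open>Fejer kernel and Fejer means\<close>

definition fejer_weight :: "nat \<Rightarrow> int \<Rightarrow> real" where
  "fejer_weight N n = 1 - \<bar>of_int n\<bar> / (real N + 1)"

text \<open>The square form gives nonnegativity and \<open>fejer_kernel_decay\<close> at once; the
  trigonometric form with the weights is \<open>fejer_kernel_eq\<close>.\<close>

definition fejer_kernel :: "nat \<Rightarrow> real \<Rightarrow> real" where
  "fejer_kernel N x = (cmod (\<Sum>k\<le>N. cis (of_nat k * x)))\<^sup>2 / (real N + 1)"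

definition fejer_sum :: "(real \<Rightarrow> real) \<Rightarrow> nat \<Rightarrow> real \<Rightarrow> complex" where
  "fejer_sum f N t = (\<Sum>n\<in>{-int N..int N}. of_real (fejer_weight N n) * fourier_coeff f n * cis (of_int n * t))"

lemma symmetric_int_interval_Suc:
  "{-int (Suc N)..int (Suc N)} = insert (int (Suc N)) (insert (- int (Suc N)) {-int N..int N})"
  by auto

lemma sum_symmetric_int_interval:
  fixes f :: "int \<Rightarrow> complex"
  shows "(\<Sum>n\<in>{-int N..int N}. f n) = f 0 + (\<Sum>k<N. f (int (Suc k)) + f (- int (Suc k)))"
  by (induction N) (simp_all add: symmetric_int_interval_Suc del: of_nat_Suc)

text \<open>Among the pairs (j, k) with entries up to \<open>N\<close>, the difference n occurs N +
  1 - |n| times. Passing to \<open>Suc N\<close> adds one row and one column, in which each n of the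
  larger symmetric range occurs exactly once.\<close>

lemma sum_differences_fejer:
  fixes f :: "int \<Rightarrow> complex"
  shows "(\<Sum>j\<le>N. \<Sum>k\<le>N. f (int j - int k)) = (\<Sum>n\<in>{-int N..int N}. of_int (int N + 1 - \<bar>n\<bar>) * f n)"
proof (induction N)
  case (Suc N)
  have 1: "(\<Sum>k\<le>N. f (int (Suc N) - int k)) = (\<Sum>k<Suc N. f (int (Suc k)))"
    unfolding lessThan_Suc_atMost[symmetric]
    by (subst sum.nat_diff_reindex[symmetric]) (intro sum.cong refl arg_cong[of _ _ f], auto simp: of_nat_diff)
  have 2: "(\<Sum>k\<le>N. f (int k - int (Suc N))) = (\<Sum>k<Suc N. f (- int (Suc k)))"
    unfolding lessThan_Suc_atMost[symmetric]
    by (subst sum.nat_diff_reindex[symmetric]) (intro sum.cong refl arg_cong[of _ _ f], auto simp: of_nat_diff)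
  have "(\<Sum>j\<le>Suc N. \<Sum>k\<le>Suc N. f (int j - int k))
    = (\<Sum>j\<le>N. \<Sum>k\<le>N. f (int j - int k)) + (\<Sum>k\<le>N. f (int (Suc N) - int k)) + (\<Sum>k\<le>N. f (int k - int (Suc N))) + f 0"
    by (simp add: sum.distrib)
  also have "\<dots> = (\<Sum>n\<in>{-int N..int N}. of_int (int N + 1 - \<bar>n\<bar>) * f n) + (\<Sum>n\<in>{-int (Suc N)..int (Suc N)}. f n)"
    unfolding Suc 1 2 sum_symmetric_int_interval[of f "Suc N"] by (simp add: sum.distrib)
  \<comment> \<open>The two indices that are new in the larger range carry the weight N + 1 - (N +
    1) = 0.\<close>
  also have "(\<Sum>n\<in>{-int N..int N}. of_int (int N + 1 - \<bar>n\<bar>) * f n)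
      = (\<Sum>n\<in>{-int (Suc N)..int (Suc N)}. of_int (int N + 1 - \<bar>n\<bar>) * f n)"
    by (simp add: symmetric_int_interval_Suc del: of_nat_Suc) simp
  finally show ?case
    by (simp only: flip: sum.distrib) (intro sum.cong refl, simp add: algebra_simps)
qed simp

lemma fejer_kernel_eq:
  "complex_of_real (fejer_kernel N x) = (\<Sum>n\<in>{-int N..int N}. of_real (fejer_weight N n) * cis (of_int n * x))"
proof -
  have "fejer_kernel N x * (real N + 1) = (cmod (\<Sum>k\<le>N. cis (of_nat k * x)))\<^sup>2"
    by (simp add: fejer_kernel_def)
  then have "complex_of_real (fejer_kernel N x * (real N + 1)) = of_real ((cmod (\<Sum>k\<le>N. cis (of_nat k * x)))\<^sup>2)"
    by (rule arg_cong)
  then have "complex_of_real (fejer_kernel N x) * (of_nat N + 1)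
      = (\<Sum>j\<le>N. cis (of_nat j * x)) * cnj (\<Sum>k\<le>N. cis (of_nat k * x))"
    by (simp only: complex_norm_square of_real_mult of_real_add of_real_of_nat_eq of_real_1)
  also have "\<dots> = (\<Sum>j\<le>N. \<Sum>k\<le>N. cis (of_int (int j - int k) * x))"
    by (simp add: sum_product cis_cnj cis_mult algebra_simps)
  also have "\<dots> = (\<Sum>n\<in>{-int N..int N}. of_int (int N + 1 - \<bar>n\<bar>) * cis (of_int n * x))"
    by (rule sum_differences_fejer)
  also have "\<dots> = (\<Sum>n\<in>{-int N..int N}. of_real (fejer_weight N n) * cis (of_int n * x)) * (of_nat N + 1)"
  proof -
    have "complex_of_int (int N + 1 - \<bar>n\<bar>) = of_real (fejer_weight N n) * (of_nat N + 1)" for n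
    proof -
      have "real_of_int (int N + 1 - \<bar>n\<bar>) = fejer_weight N n * (real N + 1)"
        by (simp add: fejer_weight_def field_simps)
      then have "complex_of_real (real_of_int (int N + 1 - \<bar>n\<bar>)) = of_real (fejer_weight N n * (real N + 1))"
        by (rule arg_cong)
      then show ?thesis by (simp only: of_real_mult of_real_add of_real_of_nat_eq of_real_1 of_real_of_int_eq)
    qed
    then show ?thesis by (simp add: sum_distrib_left mult_ac)
  qed
  finally show ?thesis
    using mult_right_cancel[of "complex_of_nat N + 1"] of_nat_neq_0[of N, where 'a = complex]
    by (simp only: of_nat_Suc add.commute[of 1]) blast
qed

lemma fejer_kernel_nonneg: "fejer_kernel N x \<ge> 0"
  by (simp add: fejer_kernel_def)

lemma continuous_on_fejer_kernel [continuous_intros]: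
  "continuous_on S f \<Longrightarrow> continuous_on S (\<lambda>x. fejer_kernel N (f x))" for f :: "real \<Rightarrow> real"
  unfolding fejer_kernel_def by (intro continuous_intros) auto

lemma fejer_sum_eq_integral:
  assumes "continuous_on UNIV f"
  shows "fejer_sum f N t = of_real (integral {-pi..pi} (\<lambda>s. f s * fejer_kernel N (t - s)) / (2 * pi))"
proof -
  have "complex_of_real (integral {-pi..pi} (\<lambda>s. f s * fejer_kernel N (t - s)))
     = integral {-pi..pi} (\<lambda>s. of_real (f s * fejer_kernel N (t - s)))"
    by (intro integral_unique[symmetric] has_integral_of_real integrable_integral
        integrable_continuous_interval continuous_intros continuous_on_subset[OF assms]) auto
  also have "\<dots> = integral {-pi..pi} (\<lambda>s. \<Sum>n\<in>{-int N..int N}.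
        of_real (fejer_weight N n) * cis (of_int n * t) * (of_real (f s) * cis (- (of_int n * s))))"
    by (intro integral_cong) (simp add: fejer_kernel_eq sum_distrib_left cis_mult algebra_simps cis_divide[symmetric])
  also have "\<dots> = (\<Sum>n\<in>{-int N..int N}. of_real (fejer_weight N n) * cis (of_int n * t) * (fourier_coeff f n * (2 * of_real pi)))"
    by (subst integral_sum)
       (auto intro!: integrable_on_mult_right fourier_integrand_integrable assms sum.cong simp: fourier_coeff_cis)
  also have "\<dots> = fejer_sum f N t * (2 * of_real pi)"
    by (simp add: fejer_sum_def sum_distrib_left mult_ac)
  finally show ?thesis by (simp add: field_simps)
qed

lemma integral_fejer_kernel: "((\<lambda>s. fejer_kernel N (t - s)) has_integral 2 * pi) {-pi..pi}"
proof -
  have "fourier_coeff (\<lambda>t. 1) n = (if n = 0 then 1 else 0)" for n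
    using fourier_coeff_trig_monomial[of "1/2" 0 n] by simp
  then have "fejer_sum (\<lambda>t. 1) N t = 1"
    by (simp add: fejer_sum_def fejer_weight_def if_distrib[of "\<lambda>x. _ * x"] if_distrib[of "\<lambda>x. x * _"] sum.delta cong: if_cong)
  then have "complex_of_real (integral {-pi..pi} (\<lambda>s. fejer_kernel N (t - s)) / (2 * pi)) = 1"
    unfolding fejer_sum_eq_integral[OF continuous_on_const] by (simp only: mult_1_left)
  then have "integral {-pi..pi} (\<lambda>s. fejer_kernel N (t - s)) = 2 * pi"
    unfolding of_real_eq_1_iff by (metis divide_eq_1_iff)
  moreover have "(\<lambda>s. fejer_kernel N (t - s)) integrable_on {-pi..pi}"
    by (intro integrable_continuous_interval continuous_intros)
  ultimately show ?thesis by (simp add: has_integral_iff)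
qed

text \<open>Multiplying the geometric sum by \<open>1 - cis x\<close> telescopes it to a difference
  of two points of the unit circle, of modulus at most 2.\<close>

lemma fejer_kernel_decay: "(cmod (1 - cis x))\<^sup>2 * fejer_kernel N x \<le> 4 / (real N + 1)"
proof -
  have "(1 - cis x) * (\<Sum>k\<le>N. cis (of_nat k * x)) = 1 - cis (of_nat (Suc N) * x)"
    using one_diff_power_eq[of "cis x" "Suc N"] by (simp only: Complex.DeMoivre lessThan_Suc_atMost)
  then have "cmod (1 - cis x) * cmod (\<Sum>k\<le>N. cis (of_nat k * x)) = cmod (1 - cis (of_nat (Suc N) * x))"
    by (metis norm_mult)
  also have "\<dots> \<le> 2"
    using norm_triangle_ineq4[of 1 "cis (of_nat (Suc N) * x)"] by simp
  finally have "(cmod (1 - cis x) * cmod (\<Sum>k\<le>N. cis (of_nat k * x)))\<^sup>2 \<le> 2\<^sup>2"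
    by (intro power_mono) auto
  then show ?thesis
    unfolding fejer_kernel_def by (simp add: power_mult_distrib divide_right_mono)
qed

text \<open>Since the kernel has mean 1, the error is the average of f(s) - f(t) against it. The
  Lipschitz bound is linear in the chord while the decay of the kernel is stated for its square;
  reconciling the two costs the rate 1 / sqrt (N + 1).\<close>

lemma fejer_sum_approx:
  assumes cont: "continuous_on UNIV f" and R: "\<And>s t. \<bar>f s - f t\<bar> \<le> R * cmod (1 - cis (t - s))"
  shows "\<bar>Re (fejer_sum f N t) - f t\<bar> \<le> 5 * R / (2 * sqrt (real N + 1))"
proof -
  \<comment> \<open>Balances the two terms of chord <= (\<delta> + chord^2 / \<delta>) / 2: after
    averaging they contribute \<delta> and 4 / (\<delta> (N + 1)) = 4 \<delta>, whence the constant
    5.\<close>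
  define \<delta> where "\<delta> = 1 / sqrt (real N + 1)"
  have \<delta>: "\<delta> > 0" by (simp add: \<delta>_def)
  have "R * 2 \<ge> 0" using R[of 0 pi] by (simp add: cis_pi)
  then have "R \<ge> 0" by simp
  let ?K = "\<lambda>s. fejer_kernel N (t - s)"
  have int1: "(\<lambda>s. f s * ?K s) integrable_on {-pi..pi}"
    by (intro integrable_continuous_interval continuous_intros continuous_on_subset[OF cont]) auto
  have int2: "((\<lambda>s. (f s - f t) * ?K s) has_integral integral {-pi..pi} (\<lambda>s. f s * ?K s) - f t * (2 * pi)) {-pi..pi}"
    unfolding left_diff_distrib
    by (intro has_integral_diff integrable_integral int1 has_integral_mult_right integral_fejer_kernel)
  have bound: "\<bar>(f s - f t) * ?K s\<bar> \<le> R / 2 * (\<delta> * ?K s + 4 / (\<delta> * (real N + 1)))" for s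
  proof -
    let ?c = "cmod (1 - cis (t - s))"
    have "0 \<le> (?c - \<delta>)\<^sup>2 / \<delta>" using \<delta> by simp
    then have "?c \<le> (\<delta> + ?c\<^sup>2 / \<delta>) / 2"
      using \<delta> by (simp add: power2_eq_square field_simps)
    then have "?c * ?K s \<le> (\<delta> + ?c\<^sup>2 / \<delta>) / 2 * ?K s"
      by (rule mult_right_mono) (rule fejer_kernel_nonneg)
    also have "\<dots> = (\<delta> * ?K s + (?c\<^sup>2 * ?K s) / \<delta>) / 2" by (simp add: field_simps)
    also have "\<dots> \<le> (\<delta> * ?K s + (4 / (real N + 1)) / \<delta>) / 2"
      using \<delta> fejer_kernel_decay[of "t - s" N] by (intro divide_right_mono add_left_mono) auto
    finally have "R * (?c * ?K s) \<le> R * ((\<delta> * ?K s + (4 / (real N + 1)) / \<delta>) / 2)"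
      using \<open>R \<ge> 0\<close> by (rule mult_left_mono)
    moreover have "\<bar>(f s - f t) * ?K s\<bar> \<le> R * ?c * ?K s"
      unfolding abs_mult abs_of_nonneg[OF fejer_kernel_nonneg]
      by (intro mult_right_mono R fejer_kernel_nonneg)
    ultimately show ?thesis by (simp add: mult_ac)
  qed
  have "\<bar>integral {-pi..pi} (\<lambda>s. f s * ?K s) - f t * (2 * pi)\<bar>
      \<le> R / 2 * (\<delta> * (2 * pi) + 4 / (\<delta> * (real N + 1)) * (2 * pi))"
  proof -
    have c: "((\<lambda>s. 4 / (\<delta> * (real N + 1))) has_integral 4 / (\<delta> * (real N + 1)) * (2 * pi)) {-pi..pi}"
      using has_integral_const_real[of "4 / (\<delta> * (real N + 1))" "-pi" pi] by (simp add: mult.commute)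
    have "((\<lambda>s. R / 2 * (\<delta> * ?K s + 4 / (\<delta> * (real N + 1)))) has_integral
        R / 2 * (\<delta> * (2 * pi) + 4 / (\<delta> * (real N + 1)) * (2 * pi))) {-pi..pi}"
      by (intro has_integral_mult_right has_integral_add integral_fejer_kernel c)
    then show ?thesis
      using int2 bound integral_norm_bound_integral[of "\<lambda>s. (f s - f t) * ?K s" "{-pi..pi}" "\<lambda>s. R / 2 * (\<delta> * ?K s + 4 / (\<delta> * (real N + 1)))"]
      by (auto simp: has_integral_iff)
  qed
  also have "\<dots> = (5 * R / (2 * sqrt (real N + 1))) * (2 * pi)"
  proof -
    have "\<delta> * (real N + 1) = sqrt (real N + 1)"
      by (simp add: \<delta>_def field_simps)
    then show ?thesis unfolding \<open>\<delta> * (real N + 1) = _\<close> by (simp add: \<delta>_def field_simps)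
  qed
  finally have "\<bar>integral {-pi..pi} (\<lambda>s. f s * ?K s) / (2 * pi) - f t\<bar> * (2 * pi) \<le> (5 * R / (2 * sqrt (real N + 1))) * (2 * pi)"
    by (subst abs_mult_pos) (simp_all add: left_diff_distrib)
  then have "\<bar>integral {-pi..pi} (\<lambda>s. f s * ?K s) / (2 * pi) - f t\<bar> \<le> 5 * R / (2 * sqrt (real N + 1))"
    by (rule mult_right_le_imp_le) simp
  then show ?thesis
    by (simp only: fejer_sum_eq_integral[OF cont] Re_complex_of_real)
qed

text \<open>The second difference \<open>g\<close> of \<open>f\<close> is nonnegative, and taking
  Fejer means commutes with translations. So the difference of the two sides is the Fejer mean of
  \<open>g\<close>, an integral of \<open>g\<close> against a nonnegative kernel.\<close>

lemma fejer_sum_second_difference: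
  assumes cont: "continuous_on UNIV f" and per: "\<And>t. f (t + 2 * pi) = f t"
    and diff: "\<And>t. f (t + d) + f (t - d) \<ge> 2 * cos d * f t"
  shows "Re (fejer_sum f N (t + d)) + Re (fejer_sum f N (t - d)) \<ge> 2 * cos d * Re (fejer_sum f N t)"
proof -
  define g where "g s = (f (s + d) + f (s + - d)) + (- 2 * cos d) * f s" for s
  have c: "continuous_on UNIV (\<lambda>s. f (s + a))" for a
    by (intro continuous_intros continuous_on_compose2[OF cont]) auto
  have gc: "continuous_on UNIV g"
    unfolding g_def by (intro continuous_intros c cont)
  have coeff: "fourier_coeff g n = (cis (of_int n * d) + cis (- (of_int n * d)) - of_real (2 * cos d)) * fourier_coeff f n" for n
  proof -
    have "fourier_coeff g n = (fourier_coeff (\<lambda>s. f (s + d)) n + fourier_coeff (\<lambda>s. f (s + - d)) n)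
        + of_real (- 2 * cos d) * fourier_coeff f n"
      unfolding g_def by (intro trans[OF fourier_coeff_add] arg_cong2[of _ _ _ _ "(+)"] fourier_coeff_cmult
          fourier_coeff_add continuous_intros c cont)
    also have "\<dots> = (cis (of_int n * d) + cis (- (of_int n * d)) - of_real (2 * cos d)) * fourier_coeff f n"
      by (simp only: fourier_coeff_shift[OF cont per]) (simp add: algebra_simps)
    finally show ?thesis .
  qed
  have cis: "cis (of_int n * (t + d)) = cis (of_int n * d) * cis (of_int n * t)"
    "cis (of_int n * (t - d)) = cis (- (of_int n * d)) * cis (of_int n * t)" for n
    by (simp_all add: cis_mult algebra_simps)
  have "fejer_sum g N t = fejer_sum f N (t + d) + fejer_sum f N (t - d) - of_real (2 * cos d) * fejer_sum f N t"
    unfolding fejer_sum_def sum_distrib_left sum.distrib[symmetric] sum_subtractf[symmetric]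
    unfolding coeff cis by (intro sum.cong refl) (simp add: algebra_simps)
  moreover have "Re (fejer_sum g N t) \<ge> 0"
    unfolding fejer_sum_eq_integral[OF gc] Re_complex_of_real
    using diff
    by (intro divide_nonneg_pos integral_nonneg integrable_continuous_interval continuous_intros
        continuous_on_subset[OF gc] mult_nonneg_nonneg fejer_kernel_nonneg) (auto simp: g_def)
  ultimately show ?thesis by simp
qed

text \<open>Both functions are limits of the same sequence of Fejer sums.\<close>

lemma fourier_coeff_inj:
  assumes "continuous_on UNIV f" "\<And>s t. \<bar>f s - f t\<bar> \<le> R * cmod (1 - cis (t - s))"
    and "continuous_on UNIV g" "\<And>s t. \<bar>g s - g t\<bar> \<le> R' * cmod (1 - cis (t - s))"
    and eq: "\<And>n. fourier_coeff f n = fourier_coeff g n"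
  shows "f = g"
proof
  fix t
  have "(\<lambda>N. 5 * S / (2 * sqrt (real N + 1))) \<longlonglongrightarrow> 0" for S
    by real_asymp
  moreover have "\<bar>Re (fejer_sum f N t) - f t\<bar> \<le> 5 * R / (2 * sqrt (real N + 1))"
     "\<bar>Re (fejer_sum f N t) - g t\<bar> \<le> 5 * R' / (2 * sqrt (real N + 1))" for N
    using fejer_sum_approx[OF assms(1,2)] fejer_sum_approx[OF assms(3,4)]
    by (simp_all add: fejer_sum_def eq)
  ultimately have "(\<lambda>N. Re (fejer_sum f N t) - f t) \<longlonglongrightarrow> 0" "(\<lambda>N. Re (fejer_sum f N t) - g t) \<longlonglongrightarrow> 0"
    by (metis (mono_tags, lifting) Lim_null_comparison always_eventually real_norm_def)+
  then have "(\<lambda>N. Re (fejer_sum f N t)) \<longlonglongrightarrow> f t" "(\<lambda>N. Re (fejer_sum f N t)) \<longlonglongrightarrow> g t"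
    by (simp_all add: LIM_zero_iff)
  then show "f t = g t" by (rule LIMSEQ_unique)
qed

lemma fejer_weight_tendsto: "(\<lambda>N. fejer_weight N n) \<longlonglongrightarrow> 1"
  unfolding fejer_weight_def by real_asymp

lemma fejer_weight_uminus [simp]: "fejer_weight N (- n) = fejer_weight N n"
  by (simp add: fejer_weight_def)

lemma fejer_weight_zero [simp]: "fejer_weight N 0 = 1"
  by (simp add: fejer_weight_def)

section \<open>The area of a body with smooth support function\<close>

text \<open>Tonelli's theorem on pairs of reals, carried over by \<open>T\<close>. That
  \<open>T\<close> preserves Lebesgue measure is checked on open boxes, whose preimages are boxes
  with the same sides.\<close>

lemma emeasure_lborel_vec2:
  fixes A :: "(real^2) set"
  assumes [measurable]: "A \<in> sets borel"
  shows "emeasure lborel A = (\<integral>\<^sup>+x. emeasure lborel {y. vector [x, y] \<in> A} \<partial>lborel)"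
proof -
  define T :: "real \<times> real \<Rightarrow> real^2" where "T z = vector [fst z, snd z]" for z
  have T: "T z = fst z *\<^sub>R axis 1 1 + snd z *\<^sub>R axis 2 1" for z
    by (simp add: T_def vec_eq_iff forall_2 axis_def)
  have [measurable]: "T \<in> borel \<rightarrow>\<^sub>M borel"
    unfolding T by (intro borel_measurable_continuous_onI continuous_intros)
  have "lborel = distr (lborel :: (real \<times> real) measure) borel T"
  proof (rule lborel_eqI)
    fix l u :: "real^2"
    assume le: "\<And>b. b \<in> Basis \<Longrightarrow> l \<bullet> b \<le> u \<bullet> b"
    have le': "l $ i \<le> u $ i" for i
      using le[of "axis i 1"] by (simp add: inner_axis axis_in_Basis_iff)
    have "T -` box l u = box (l$1, l$2) (u$1, u$2)"
      by (auto simp: T_def mem_box_cart forall_2 mem_box Basis_prod_def)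
    then have "emeasure (distr lborel borel T) (box l u) = emeasure lborel (box (l$1, l$2) (u$1, u$2))"
      by (subst emeasure_distr) auto
    also have "\<dots> = ennreal ((u$1 - l$1) * (u$2 - l$2))"
      using le' by (subst emeasure_lborel_box) (auto simp: Basis_prod_def prod.union_disjoint)
    also have "(u$1 - l$1) * (u$2 - l$2) = (\<Prod>b\<in>Basis. (u - l) \<bullet> b)"
    proof -
      have B: "Basis = {axis 1 1, axis 2 (1::real) :: real^2}"
        by (auto simp: Basis_vec_def) (metis exhaust_2)
      show ?thesis by (subst B) (simp add: inner_axis axis_eq_axis)
    qed
    finally show "emeasure (distr lborel borel T) (box l u) = ennreal (\<Prod>b\<in>Basis. (u - l) \<bullet> b)" .
  qed simp
  then have "emeasure lborel A = emeasure (distr (lborel :: (real \<times> real) measure) borel T) A"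
    by (rule arg_cong[where f = "\<lambda>m. emeasure m A"])
  also have "\<dots> = emeasure (lborel \<Otimes>\<^sub>M lborel) (T -` A)"
    by (subst emeasure_distr) (auto simp: lborel_prod)
  also have "\<dots> = (\<integral>\<^sup>+x. emeasure lborel (Pair x -` (T -` A)) \<partial>lborel)"
  proof (rule lborel.emeasure_pair_measure_alt)
    show "T -` A \<in> sets (lborel \<Otimes>\<^sub>M lborel)"
      unfolding lborel_prod sets_lborel using measurable_sets[of T borel borel A] by simp
  qed
  also have "\<dots> = (\<integral>\<^sup>+x. emeasure lborel {y. vector [x, y] \<in> A} \<partial>lborel)"
    by (intro nn_integral_cong arg_cong2[of _ _ _ _ emeasure]) (auto simp: T_def)
  finally show ?thesis .
qed

text \<open>Where \<open>X\<close> is injective, the curve (X, Y) is the graph of a continuous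
  \<open>f\<close>. The difference of two integrals covers both orientations: the reversed interval
  is empty or a point and contributes 0.\<close>

lemma integral_inverse_substitution:
  fixes X Y X' :: "real \<Rightarrow> real"
  assumes "a \<le> b" and der: "\<And>t. t \<in> {a..b} \<Longrightarrow> (X has_real_derivative X' t) (at t)"
    and Y: "continuous_on {a..b} Y" and inj: "inj_on X {a..b}" and im: "X ` {a..b} = {c..d}"
  obtains f where "continuous_on {c..d} f" "\<And>t. t \<in> {a..b} \<Longrightarrow> f (X t) = Y t"
    "((\<lambda>t. X' t * Y t) has_integral (integral {X a..X b} f - integral {X b..X a} f)) {a..b}"
proof -
  define g where "g = inv_into {a..b} X"
  have X: "continuous_on {a..b} X"
    using der by (meson DERIV_continuous_on has_field_derivative_at_within)
  have g: "g (X t) = t" if "t \<in> {a..b}" for t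
    using inj that by (simp add: g_def)
  have "continuous_on (X ` {a..b}) g"
    using X g by (intro continuous_on_inv) auto
  moreover have "g ` {c..d} \<subseteq> {a..b}"
    using g by (auto simp flip: im)
  ultimately have cont: "continuous_on {c..d} (Y \<circ> g)"
    using Y unfolding im by (blast intro: continuous_on_compose continuous_on_subset)
  have "((\<lambda>t. X' t *\<^sub>R (Y \<circ> g) (X t)) has_integral
      (integral {X a..X b} (Y \<circ> g) - integral {X b..X a} (Y \<circ> g))) {a..b}"
    using assms cont X
    by (intro has_integral_substitution_general[of "{}"]) (auto intro: has_field_derivative_at_within)
  then have "((\<lambda>t. X' t * Y t) has_integral (integral {X a..X b} (Y \<circ> g) - integral {X b..X a} (Y \<circ> g))) {a..b}"
    by (rule has_integral_eq[rotated]) (simp add: g)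
  with cont g show thesis by (intro that[of "Y \<circ> g"]) auto
qed

section \<open>The boundary curve of a body with smooth support function\<close>

locale smooth_support =
  fixes p p1 p2 :: "real \<Rightarrow> real"
  assumes p_deriv: "\<And>t. (p has_real_derivative p1 t) (at t)"
    and p1_deriv: "\<And>t. (p1 has_real_derivative p2 t) (at t)"
    and p2_cont: "continuous_on UNIV p2"
    and p_periodic: "\<And>t. p (t + 2 * pi) = p t"
    and radius_pos: "\<And>t. p t + p2 t > 0"
begin

text \<open>The radius of curvature, and the coordinates of the boundary point with outer normal
  direction t, which is \<open>p t\<close> times direction t plus \<open>p1 t\<close> times
  direction t + \<pi>/2.\<close>

definition radius where "radius t = p t + p2 t"
definition bdx where "bdx t = p t * cos t - p1 t * sin t"
definition bdy where "bdy t = p t * sin t + p1 t * cos t"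

lemma bdx_deriv: "(bdx has_real_derivative - (radius t * sin t)) (at t)"
  unfolding bdx_def radius_def
  by (rule derivative_eq_intros p_deriv p1_deriv refl)+ (simp add: algebra_simps)

lemma bdy_deriv: "(bdy has_real_derivative radius t * cos t) (at t)"
  unfolding bdy_def radius_def
  by (rule derivative_eq_intros p_deriv p1_deriv refl)+ (simp add: algebra_simps)

lemma p1_periodic: "p1 (t + 2 * pi) = p1 t"
proof -
  have "((\<lambda>t. p (t + 2 * pi)) has_real_derivative p1 (t + 2 * pi)) (at t)"
    using p_deriv[of "t + 2 * pi"] by (simp only: DERIV_shift)
  then show ?thesis using p_deriv DERIV_unique by (simp add: p_periodic) blast
qed

lemma bdxy_periodic: "bdx (t + 2 * pi) = bdx t" "bdy (t + 2 * pi) = bdy t"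
  by (simp_all add: bdx_def bdy_def p_periodic p1_periodic)

lemma cont_bdxy [continuous_intros]: "continuous_on S p" "continuous_on S bdx" "continuous_on S bdy" "continuous_on S radius"
proof -
  show p: "continuous_on S p"
    by (rule DERIV_continuous_on, rule has_field_derivative_at_within, rule p_deriv)
  show "continuous_on S bdx" "continuous_on S bdy"
    by (rule DERIV_continuous_on, rule has_field_derivative_at_within, rule bdx_deriv bdy_deriv)+
  show "continuous_on S radius"
    using continuous_on_add[OF p continuous_on_subset[OF p2_cont subset_UNIV]]
    by (simp add: radius_def[abs_def])
qed

lemma radius_gt_0: "radius t > 0"
  by (simp add: radius_def radius_pos)

lemma p_eq: "p t = bdx t * cos t + bdy t * sin t"
proof -
  have "bdx t * cos t + bdy t * sin t = p t * ((sin t)\<^sup>2 + (cos t)\<^sup>2)"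
    unfolding bdx_def bdy_def by algebra
  then show ?thesis by simp
qed

text \<open>As a function of \<open>s\<close>, the difference \<open>F\<close> of the two sides solves \<open>F'' + F = radius (t + s)\<close> with
  \<open>F 0 = F' 0 = 0\<close>; \<open>G\<close> below comes from variation of constants and satisfies \<open>G s = F s\<close>.\<close>

lemma boundary_point_below_near:
  assumes "\<bar>s\<bar> \<le> pi"
  shows "p t * cos s + p1 t * sin s \<le> p (t + s)"
proof -
  define G where "G x = (p1 (t + x) + p t * sin x - p1 t * cos x) * sin (s - x)
      + (p (t + x) - p t * cos x - p1 t * sin x) * cos (s - x)" for x
  have G: "(G has_real_derivative radius (t + x) * sin (s - x)) (at x)" for x
  proof -
    have "((\<lambda>x. p (t + x)) has_real_derivative p1 (t + x)) (at x)"
      "((\<lambda>x. p1 (t + x)) has_real_derivative p2 (t + x)) (at x)"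
      using DERIV_shift[of p _ x t] DERIV_shift[of p1 _ x t] p_deriv[of "t + x"] p1_deriv[of "t + x"]
      by (simp_all add: add.commute)
    note [derivative_intros] = this
    show ?thesis
      unfolding G_def radius_def
      by (rule derivative_eq_intros refl)+ (simp add: algebra_simps)
  qed
  have "G 0 \<le> G s"
  proof (cases "s \<ge> 0")
    case True
    show ?thesis
    proof (rule DERIV_nonneg_imp_nondecreasing[OF True])
      fix x assume "0 \<le> x" "x \<le> s"
      then show "\<exists>y. (G has_real_derivative y) (at x) \<and> 0 \<le> y"
        using G assms radius_gt_0[of "t + x"]
        by (intro exI[of _ "radius (t + x) * sin (s - x)"] conjI mult_nonneg_nonneg sin_ge_zero) auto
    qed
  next
    case False
    then have "s \<le> 0" by simp
    then show ?thesis
    proof (rule DERIV_nonpos_imp_nonincreasing)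
      fix x assume "s \<le> x" "x \<le> 0"
      then have "sin (- (s - x)) \<ge> 0" using assms by (intro sin_ge_zero) auto
      then show "\<exists>y. (G has_real_derivative y) (at x) \<and> y \<le> 0"
        using G radius_gt_0[of "t + x"] unfolding sin_minus
        by (intro exI[of _ "radius (t + x) * sin (s - x)"] conjI mult_nonneg_nonpos) auto
    qed
  qed
  then show ?thesis by (simp add: G_def)
qed

text \<open>Rotating by \<open>t\<close> reduces this to \<open>boundary_point_below_near\<close>,
  which covers one full period around \<open>t\<close>. In effect the boundary point at
  \<open>t\<close> satisfies every constraint of \<open>wulff p\<close>.\<close>

lemma boundary_point_below: "bdx t * cos s + bdy t * sin s \<le> p s"
proof -
  interpret periodic_fun_simple p "2 * pi"
    by unfold_locales (rule p_periodic)
  obtain r k where "\<bar>r\<bar> \<le> pi" and s: "s = t + r + of_int k * (2 * pi)"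
    by (rule angle_reduction)
  have "p s = p (t + r)"
    unfolding s by (rule plus_of_int)
  moreover have "cos s = cos (t + r)" "sin s = sin (t + r)"
    unfolding s using cos.plus_of_int[of "t + r" k] sin.plus_of_int[of "t + r" k] by (simp_all add: algebra_simps)
  moreover have "bdx t * cos (t + r) + bdy t * sin (t + r) = (p t * cos r + p1 t * sin r) * ((sin t)\<^sup>2 + (cos t)\<^sup>2)"
    unfolding bdx_def bdy_def by (simp only: cos_add sin_add) algebra
  ultimately show ?thesis
    using boundary_point_below_near[OF \<open>\<bar>r\<bar> \<le> pi\<close>, of t] by simp
qed

text \<open>The derivative of \<open>bdx\<close> is minus the radius times sin t, which is negative
  between 0 and \<pi> and positive between \<pi> and 2 \<pi>. The boundary thus splits into two
  graphs over the same interval.\<close>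

lemma bdx_image_upper: "bdx ` {0..pi} = {bdx pi..bdx 0}" and bdx_inj_upper: "inj_on bdx {0..pi}"
proof -
  have dec: "bdx s > bdx t" if "s < t" "s \<in> {0..pi}" "t \<in> {0..pi}" for s t
  proof (rule DERIV_neg_imp_decreasing_open[OF \<open>s < t\<close>])
    fix x assume "s < x" "x < t"
    then have "sin x > 0" using that by (intro sin_gt_zero) auto
    then show "\<exists>y. (bdx has_real_derivative y) (at x) \<and> y < 0"
      using bdx_deriv[of x] radius_gt_0[of x] by (intro exI[of _ "- (radius x * sin x)"]) simp
  qed (rule cont_bdxy)
  show "inj_on bdx {0..pi}" by (rule linorder_inj_onI) (use dec in \<open>fastforce+\<close>)
  obtain c d where cd: "bdx ` {0..pi} = {c..d}"
    using continuous_image_closed_interval[of 0 pi bdx] cont_bdxy by auto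
  have "bdx t \<in> {bdx pi..bdx 0}" if "t \<in> {0..pi}" for t
    using that dec[of 0 t] dec[of t pi] by (cases "t = 0"; cases "t = pi") (auto simp: less_imp_le)
  moreover have "bdx 0 \<in> bdx ` {0..pi}" "bdx pi \<in> bdx ` {0..pi}" by auto
  moreover have "c \<le> d" using cd by (metis atLeastatMost_empty_iff atLeastatMost_empty_iff2 image_is_empty pi_ge_zero)
  ultimately show "bdx ` {0..pi} = {bdx pi..bdx 0}"
    using cd by (metis atLeastAtMost_iff imageE order_antisym order_refl)
qed

lemma bdx_image_lower: "bdx ` {pi..2*pi} = {bdx pi..bdx 0}" and bdx_inj_lower: "inj_on bdx {pi..2*pi}"
proof -
  have per: "bdx (2 * pi) = bdx 0" using bdxy_periodic(1)[of 0] by simp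
  have inc: "bdx s < bdx t" if "s < t" "s \<in> {pi..2*pi}" "t \<in> {pi..2*pi}" for s t
  proof (rule DERIV_pos_imp_increasing_open[OF \<open>s < t\<close>])
    fix x assume "s < x" "x < t"
    then have "sin x < 0" using that by (intro sin_lt_zero) auto
    then show "\<exists>y. (bdx has_real_derivative y) (at x) \<and> y > 0"
      using bdx_deriv[of x] radius_gt_0[of x] by (intro exI[of _ "- (radius x * sin x)"]) (simp add: mult_pos_neg)
  qed (rule cont_bdxy)
  show "inj_on bdx {pi..2*pi}" by (rule linorder_inj_onI) (use inc in \<open>fastforce+\<close>)
  obtain c d where cd: "bdx ` {pi..2*pi} = {c..d}"
    using continuous_image_closed_interval[of pi "2*pi" bdx] cont_bdxy by auto
  have "bdx t \<in> {bdx pi..bdx 0}" if "t \<in> {pi..2*pi}" for t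
    using that inc[of pi t] inc[of t "2*pi"] by (cases "t = pi"; cases "t = 2*pi") (auto simp: less_imp_le per)
  moreover have "bdx (2*pi) \<in> bdx ` {pi..2*pi}" "bdx pi \<in> bdx ` {pi..2*pi}" by auto
  moreover have "c \<le> d" using cd by (metis atLeastatMost_empty_iff image_is_empty pi_ge_zero mult_2 le_add_same_cancel1)
  ultimately show "bdx ` {pi..2*pi} = {bdx pi..bdx 0}"
    using cd per by (metis atLeastAtMost_iff imageE order_antisym order_refl)
qed

text \<open>The constraints for \<open>t\<close> and \<open>s\<close> alone confine the slice to the
  segment, since sin t > 0 > sin s. Conversely, on the segment a constraint with sin r >= 0 is worst
  at the upper end and one with sin r < 0 at the lower end, and both ends lie in
  \<open>wulff p\<close>.\<close>

lemma wulff_slice: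
  assumes t: "t \<in> {0<..<pi}" and s: "s \<in> {pi<..<2*pi}" and x: "bdx t = x" "bdx s = x"
  shows "{y. vector [x, y] \<in> wulff p} = {bdy s..bdy t}"
proof -
  have sin: "sin t > 0" "sin s < 0"
    using t s by (auto intro!: sin_gt_zero sin_lt_zero)
  have w: "vector [x, y] \<in> wulff p \<longleftrightarrow> (\<forall>r. x * cos r + y * sin r \<le> p r)" for y
    by (simp add: wulff_def inner_unit_dir vector_2 mult.commute)
  show ?thesis
  proof (intro set_eqI iffI; unfold mem_Collect_eq)
    fix y assume y: "vector [x, y] \<in> wulff p"
    have "y * sin t \<le> bdy t * sin t" "y * sin s \<le> bdy s * sin s"
      using y[unfolded w, rule_format, of t] y[unfolded w, rule_format, of s] x p_eq[of t] p_eq[of s] by auto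
    then show "y \<in> {bdy s..bdy t}"
      using sin by auto
  next
    fix y assume y: "y \<in> {bdy s..bdy t}"
    have "x * cos r + y * sin r \<le> p r" for r
    proof (cases "sin r \<ge> 0")
      case True
      then have "y * sin r \<le> bdy t * sin r" using y by (intro mult_right_mono) auto
      then show ?thesis using boundary_point_below[of t r] x by simp
    next
      case False
      then have "y * sin r \<le> bdy s * sin r" using y by (intro mult_right_mono_neg) auto
      then show ?thesis using boundary_point_below[of s r] x by simp
    qed
    then show "vector [x, y] \<in> wulff p" by (simp add: w)
  qed
qed

lemma wulff_slice_outside:
  assumes "x \<notin> {bdx pi..bdx 0}"
  shows "{y. vector [x, y] \<in> wulff p} = {}"
proof -
  have "x \<le> bdx 0" "- x \<le> - bdx pi" if "vector [x, y] \<in> wulff p" for y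
    using that[unfolded wulff_def mem_Collect_eq, rule_format, of 0]
      that[unfolded wulff_def mem_Collect_eq, rule_format, of pi]
    by (auto simp: inner_unit_dir vector_2 bdx_def)
  then show ?thesis using assms by fastforce
qed

text \<open>This is the integral of y against -dx along the boundary, where -dx is the radius times
  sin t dt. Slicing gives the upper graph minus the lower graph, and the opposite directions in
  which the arcs are traversed supply the signs.\<close>

lemma area_parametric: "((\<lambda>t. bdy t * radius t * sin t) has_integral measure lebesgue (wulff p)) {0..2*pi}"
proof -
  obtain u where u: "continuous_on {bdx pi..bdx 0} u" "\<And>t. t \<in> {0..pi} \<Longrightarrow> u (bdx t) = bdy t"
    "((\<lambda>t. - (radius t * sin t) * bdy t) has_integral (integral {bdx 0..bdx pi} u - integral {bdx pi..bdx 0} u)) {0..pi}"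
    by (rule integral_inverse_substitution[OF _ bdx_deriv _ bdx_inj_upper bdx_image_upper, of bdy])
       (auto intro: cont_bdxy)
  obtain l where l: "continuous_on {bdx pi..bdx 0} l" "\<And>t. t \<in> {pi..2*pi} \<Longrightarrow> l (bdx t) = bdy t"
    "((\<lambda>t. - (radius t * sin t) * bdy t) has_integral (integral {bdx pi..bdx (2*pi)} l - integral {bdx (2*pi)..bdx pi} l)) {pi..2*pi}"
    by (rule integral_inverse_substitution[OF _ bdx_deriv _ bdx_inj_lower bdx_image_lower, of bdy])
       (auto intro: cont_bdxy)
  have per: "bdx (2 * pi) = bdx 0" using bdxy_periodic(1)[of 0] by simp
  have "bdx pi \<le> bdx 0" using bdx_image_upper by (metis atLeastatMost_empty_iff2 atLeastAtMost_iff image_is_empty pi_ge_zero order_refl empty_iff)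
  have lt: "bdx pi < bdx 0"
    using \<open>bdx pi \<le> bdx 0\<close> inj_onD[OF bdx_inj_upper, of pi 0] by fastforce
  have slice: "{y. vector [x, y] \<in> wulff p} = {l x..u x} \<and> l x \<le> u x" if x: "x \<in> {bdx pi<..<bdx 0}" for x
  proof -
    obtain t where t: "t \<in> {0..pi}" "x = bdx t"
      using x bdx_image_upper by (metis atLeastAtMost_iff greaterThanLessThan_iff imageE less_imp_le)
    obtain s where s: "s \<in> {pi..2*pi}" "x = bdx s"
      using x bdx_image_lower by (metis atLeastAtMost_iff greaterThanLessThan_iff imageE less_imp_le)
    have "t \<noteq> 0" "t \<noteq> pi" "s \<noteq> pi" "s \<noteq> 2 * pi" using x t s per by auto
    then have ts: "t \<in> {0<..<pi}" "s \<in> {pi<..<2*pi}" using t s by auto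
    have "{y. vector [x, y] \<in> wulff p} = {bdy s..bdy t}"
      using wulff_slice[OF ts] t s by simp
    moreover have "bdy t \<in> {y. vector [x, y] \<in> wulff p}"
      using boundary_point_below[of t] t by (simp add: wulff_def inner_unit_dir vector_2 mult.commute)
    moreover have "u x = bdy t" "l x = bdy s"
      using u(2)[OF t(1)] l(2)[OF s(1)] t(2) s(2) by simp_all
    ultimately show ?thesis by auto
  qed
  have int: "((\<lambda>x. u x - l x) has_integral (integral {bdx pi..bdx 0} u - integral {bdx pi..bdx 0} l)) {bdx pi<..<bdx 0}"
    unfolding has_integral_Icc_iff_Ioo[symmetric]
    by (intro has_integral_diff integrable_integral integrable_continuous_interval u(1) l(1))
  have "emeasure lborel (wulff p) = (\<integral>\<^sup>+x. emeasure lborel {y. vector [x, y] \<in> wulff p} \<partial>lborel)"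
    by (intro emeasure_lborel_vec2 borel_closed convex_closed_wulff)
  also have "\<dots> = (\<integral>\<^sup>+x. ennreal (u x - l x) * indicator {bdx pi<..<bdx 0} x \<partial>lborel)"
  proof (rule nn_integral_cong_AE)
    \<comment> \<open>The two extreme abscissas are covered by neither of the slice lemmas and form
      a null set.\<close>
    have "AE x in lborel. x \<noteq> bdx pi \<and> x \<noteq> bdx 0"
      by (intro AE_conjI AE_lborel_singleton)
    then show "AE x in lborel. emeasure lborel {y. vector [x, y] \<in> wulff p} = ennreal (u x - l x) * indicator {bdx pi<..<bdx 0} x"
    proof eventually_elim
      case (elim x)
      then consider "x \<in> {bdx pi<..<bdx 0}" | "x \<notin> {bdx pi..bdx 0}" "x \<notin> {bdx pi<..<bdx 0}" by fastforce
      then show ?case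
      proof cases
        case 1
        then show ?thesis using slice[OF 1] by simp
      next
        case 2
        then show ?thesis using wulff_slice_outside[OF 2(1)] by simp
      qed
    qed
  qed
  also have "\<dots> = ennreal (integral {bdx pi..bdx 0} u - integral {bdx pi..bdx 0} l)"
    using slice by (intro nn_integral_has_integral_lebesgue' int) auto
  finally have "emeasure lborel (wulff p) = ennreal (integral {bdx pi..bdx 0} u - integral {bdx pi..bdx 0} l)" .
  moreover have "integral {bdx pi..bdx 0} u - integral {bdx pi..bdx 0} l \<ge> 0"
    using slice by (intro has_integral_nonneg[OF int]) auto
  moreover have "wulff p \<in> sets borel" by (intro borel_closed convex_closed_wulff)
  ultimately have area: "measure lebesgue (wulff p) = integral {bdx pi..bdx 0} u - integral {bdx pi..bdx 0} l"
    by (simp add: measure_def)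
  \<comment> \<open>Since \<open>bdx pi < bdx 0\<close>, this interval is empty.\<close>
  have empty: "integral {bdx 0..bdx pi} f = 0" for f :: "real \<Rightarrow> real"
    using lt by simp
  have "((\<lambda>t. - (radius t * sin t) * bdy t) has_integral
      (integral {bdx 0..bdx pi} u - integral {bdx pi..bdx 0} u) + (integral {bdx pi..bdx (2*pi)} l - integral {bdx (2*pi)..bdx pi} l)) {0..2*pi}"
    by (rule has_integral_combine[OF _ _ u(3) l(3)]) auto
  then have "((\<lambda>t. - (- (radius t * sin t) * bdy t)) has_integral measure lebesgue (wulff p)) {0..2*pi}"
    unfolding per empty area by (drule_tac has_integral_neg) simp
  then show ?thesis by (simp add: mult_ac)
qed

text \<open>With x, y the boundary coordinates, the derivative of x y integrates to 0 over a period.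
  Adding it to twice the previous integrand gives the radius times x cos t + y sin t, that is, the
  radius times p.\<close>

theorem area_wulff: "((\<lambda>t. p t * (p t + p2 t)) has_integral 2 * measure lebesgue (wulff p)) {0..2*pi}"
proof -
  have der: "((\<lambda>t. bdx t * bdy t) has_real_derivative radius t * (bdx t * cos t - bdy t * sin t)) (at t)" for t
    by (rule derivative_eq_intros bdx_deriv bdy_deriv refl)+ (simp add: algebra_simps)
  have "((\<lambda>t. radius t * (bdx t * cos t - bdy t * sin t)) has_integral (bdx (2*pi) * bdy (2*pi) - bdx 0 * bdy 0)) {0..2*pi}"
    using der by (intro fundamental_theorem_of_calculus)
      (auto simp: has_real_derivative_iff_has_vector_derivative[symmetric] intro: has_field_derivative_at_within)
  moreover have "bdx (2*pi) * bdy (2*pi) - bdx 0 * bdy 0 = 0"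
    using bdxy_periodic[of 0] by simp
  ultimately have "((\<lambda>t. radius t * (bdx t * cos t - bdy t * sin t) + 2 * (bdy t * radius t * sin t)) has_integral
      (0 + 2 * measure lebesgue (wulff p))) {0..2*pi}"
    by (intro has_integral_add has_integral_mult_right area_parametric) simp
  moreover have "radius t * (bdx t * cos t - bdy t * sin t) + 2 * (bdy t * radius t * sin t) = p t * (p t + p2 t)" for t
    unfolding radius_def[symmetric] by (subst p_eq) (simp add: algebra_simps)
  ultimately show ?thesis by simp
qed

end

section \<open>Excluded area of a convex body\<close>

definition trig_poly :: "(int \<Rightarrow> complex) \<Rightarrow> nat \<Rightarrow> real \<Rightarrow> complex" where
  "trig_poly a N t = (\<Sum>n\<in>{-int N..int N}. a n * cis (of_int n * t))"

lemma trig_poly_deriv: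
  "((\<lambda>t. Re (trig_poly a N t)) has_real_derivative Re (trig_poly (\<lambda>n. \<i> * of_int n * a n) N t)) (at t)"
proof -
  have "((\<lambda>t. Re (a n) * cos (of_int n * t) - Im (a n) * sin (of_int n * t)) has_real_derivative
      Re (\<i> * of_int n * a n * cis (of_int n * t))) (at t)" for n
    by (rule derivative_eq_intros refl | simp add: algebra_simps)+
  then show ?thesis
    unfolding trig_poly_def Re_sum by (intro DERIV_sum) simp
qed

lemma continuous_on_trig_poly: "continuous_on S (trig_poly a N)"
  unfolding trig_poly_def by (intro continuous_intros)

lemma trig_poly_periodic: "trig_poly a N (t + 2 * pi) = trig_poly a N t"
proof -
  have "cis (of_int n * (t + 2 * pi)) = cis (of_int n * t)" for n
  proof -
    have "cis (of_int n * (t + 2 * pi)) = cis (of_int n * t) * cis (2 * pi * of_int n)"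
      by (simp add: cis_mult algebra_simps)
    also have "cis (2 * pi * of_int n) = 1" by (rule cis_multiple_2pi) simp
    finally show ?thesis by simp
  qed
  then show ?thesis by (simp add: trig_poly_def)
qed

lemma trig_poly_real:
  assumes "\<And>n. a (- n) = cnj (a n)"
  shows "trig_poly a N t = of_real (Re (trig_poly a N t))"
proof -
  have "cnj (trig_poly a N t) = (\<Sum>n\<in>{-int N..int N}. a (- n) * cis (of_int (- n) * t))"
    unfolding trig_poly_def by (simp add: assms cis_cnj)
  also have "\<dots> = trig_poly a N t"
    unfolding trig_poly_def by (rule sum.reindex_bij_witness[of _ uminus uminus]) auto
  finally show ?thesis by (simp add: complex_eq_iff)
qed

text \<open>Orthogonality of the exponentials leaves only the pairs m = -n. The product carries no
  conjugation, which is why \<open>a\<close> appears at \<open>- n\<close>; for a real polynomial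
  this is the conjugate of \<open>a n\<close>.\<close>

lemma has_integral_trig_poly_mult:
  "((\<lambda>t. trig_poly a N t * trig_poly b N t) has_integral
     (of_real (2 * pi) * (\<Sum>n\<in>{-int N..int N}. a (- n) * b n))) {0..2 * pi}"
proof -
  have "((\<lambda>t. \<Sum>n\<in>{-int N..int N}. \<Sum>m\<in>{-int N..int N}. a m * b n * cis (of_int (m + n) * t)) has_integral
     (\<Sum>n\<in>{-int N..int N}. \<Sum>m\<in>{-int N..int N}. a m * b n * (if m + n = 0 then of_real (2 * pi) else 0))) {0..0 + 2 * pi}"
    by (intro has_integral_sum has_integral_mult_right has_integral_cis) auto
  moreover have "(\<Sum>m\<in>{-int N..int N}. a m * b n * (if m + n = 0 then of_real (2 * pi) else 0))
      = of_real (2 * pi) * (a (- n) * b n)" if "n \<in> {-int N..int N}" for n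
  proof -
    have "(\<Sum>m\<in>{-int N..int N}. a m * b n * (if m + n = 0 then of_real (2 * pi) else 0))
      = (\<Sum>m\<in>{-int N..int N}. if m = - n then of_real (2 * pi) * (a (- n) * b n) else 0)"
      by (intro sum.cong refl) auto
    also have "\<dots> = of_real (2 * pi) * (a (- n) * b n)"
      using that by (subst sum.delta) auto
    finally show ?thesis .
  qed
  moreover have "(\<Sum>n\<in>{-int N..int N}. \<Sum>m\<in>{-int N..int N}. a m * b n * cis (of_int (m + n) * t)) = trig_poly a N t * trig_poly b N t" for t
    unfolding trig_poly_def sum_product
    by (subst sum.swap) (intro sum.cong refl, simp add: cis_mult mult_ac distrib_left flip: cis_mult)
  ultimately show ?thesis by (simp add: sum_distrib_left del: of_real_mult)
qed

text \<open>For the second difference \<open>g\<close> at \<open>t\<close>, g(0) = g'(0) = 0 and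
  g''(0) = 2 (f(t) + D). If this were negative, \<open>g1\<close> would be negative just to the
  right of 0 and \<open>g\<close> would drop below 0.\<close>

lemma nonneg_of_second_difference:
  fixes f f1 :: "real \<Rightarrow> real"
  assumes f: "\<And>t. (f has_real_derivative f1 t) (at t)" and f1: "(f1 has_real_derivative D) (at t)"
    and diff: "\<And>d. f (t + d) + f (t - d) \<ge> 2 * cos d * f t"
  shows "f t + D \<ge> 0"
proof (rule ccontr)
  assume "\<not> f t + D \<ge> 0"
  then have neg: "2 * (f t + D) < 0" by simp
  define g where "g d = f (t + d) + f (t - d) - 2 * cos d * f t" for d
  define g1 where "g1 d = f1 (t + d) - f1 (t - d) + 2 * sin d * f t" for d
  have g: "(g has_real_derivative g1 d) (at d)" for d
    unfolding g_def g1_def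
    by (rule derivative_eq_intros DERIV_chain2[OF f] refl)+ (simp add: algebra_simps)
  have "(g1 has_real_derivative (D + D + 2 * f t)) (at 0)"
  proof -
    have "(f1 has_real_derivative D) (at ((\<lambda>d. t + d) 0))" "(f1 has_real_derivative D) (at ((\<lambda>d. t - d) 0))"
      using f1 by simp_all
    moreover have "((\<lambda>d. t + d) has_real_derivative 1) (at 0)" "((\<lambda>d. t - d) has_real_derivative - 1) (at 0)"
      by (auto intro!: derivative_eq_intros)
    ultimately have "((\<lambda>d. f1 (t + d)) has_real_derivative D * 1) (at 0)" "((\<lambda>d. f1 (t - d)) has_real_derivative D * - 1) (at 0)"
      by (blast intro: DERIV_chain2)+
    note [derivative_intros] = this
    show ?thesis
      unfolding g1_def by (rule derivative_eq_intros refl)+ simp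
  qed
  then obtain e where e: "e > 0" "\<And>h. 0 < h \<Longrightarrow> h < e \<Longrightarrow> g1 (0 + h) < g1 0"
    using DERIV_neg_dec_right[of g1 "D + D + 2 * f t" 0] neg by auto
  have "g (e / 2) < g 0"
  proof (rule DERIV_neg_imp_decreasing_open[where f = g and a = 0 and b = "e / 2"])
    fix x assume "0 < x" "x < e / 2"
    then have "g1 x < 0" using e(2)[of x] by (simp add: g1_def)
    then show "\<exists>y. (g has_real_derivative y) (at x) \<and> y < 0" using g by blast
  next
    show "continuous_on {0..e / 2} g"
      by (rule DERIV_continuous_on, rule has_field_derivative_at_within, rule g)
  qed (use e in simp)
  then show False using diff[of "e / 2"] by (simp add: g_def)
qed

text \<open>The area formula evaluated at the Fejer mean of the support function of
  \<open>rot_difference M \<theta>\<close>. The weight stands inside the square because the function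
  is smoothed, not the series of areas; the cosine factor is |1 + e^(i n (\<pi> -
  \<theta>))|^2.\<close>

definition area_partial_sum :: "(int \<Rightarrow> complex) \<Rightarrow> nat \<Rightarrow> real \<Rightarrow> real" where
  "area_partial_sum c N \<theta> = pi * (\<Sum>n\<in>{-int N..int N}.
     (1 - of_int n ^ 2) * (fejer_weight N n * cmod (c n))\<^sup>2 * (2 + 2 * cos (of_int n * (\<theta> - pi))))"

lemma convex_body_measurable: "convex_body M \<Longrightarrow> M \<in> lmeasurable"
  by (simp add: convex_body_def lmeasurable_compact)

text \<open>Smoothing the support function of \<open>M\<close> by \<open>fejer_sum\<close> keeps it a support function; adding a small
  constant makes it dominate the old one, so the smooth body encloses \<open>rot_difference M \<theta>\<close>.\<close>

lemma rot_difference_area_estimate: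
  fixes r R e \<theta> :: real
  assumes M: "convex_body M" and ball: "ball 0 r \<subseteq> M" "r > 0" and R: "\<And>x. x \<in> M \<Longrightarrow> norm x \<le> R" "R > 0"
    and e_def: "e = 5 * R / (2 * sqrt (real N + 1))"
  defines "A \<equiv> excluded_area M \<theta>"
    and "S \<equiv> area_partial_sum (fourier_coeff (support_fun M)) N \<theta> +
        pi * (8 * e * Re (fourier_coeff (support_fun M) 0) + 4 * e\<^sup>2)"
  shows "A \<le> S" "S \<le> (1 + 2 * e / r)\<^sup>2 * A"
proof -
  define h where "h = support_fun M"
  define c where "c = fourier_coeff h"
  define D where "D = rot_difference M \<theta>"
  have h_cont: "continuous_on X h" for X unfolding h_def by (rule continuous_on_support_fun[OF M])
  have h_lip: "\<bar>h s - h t\<bar> \<le> R * cmod (1 - cis (t - s))" for s t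
    unfolding h_def using support_fun_diff_le[OF M R(1)] .
  have e: "e > 0" using R by (simp add: e_def)
  have D: "convex_body D" unfolding D_def by (rule convex_body_rot_difference[OF M])
  have hD: "support_fun D t = h t + h (t - \<theta> + pi)" for t
    unfolding D_def h_def by (rule support_fun_rot_difference[OF M])
  define \<sigma> where "\<sigma> t = Re (fejer_sum h N t)" for t
  have \<sigma>_approx: "\<bar>\<sigma> t - h t\<bar> \<le> e" for t
    unfolding \<sigma>_def e_def by (rule fejer_sum_approx[OF h_cont h_lip])
  have \<sigma>_diff: "\<sigma> (t + d) + \<sigma> (t - d) \<ge> 2 * cos d * \<sigma> t" for t d
    unfolding \<sigma>_def
    by (rule fejer_sum_second_difference) (auto simp: h_def intro: h_cont[unfolded h_def] support_fun_second_difference[OF M])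
  \<comment> \<open>Coefficients of the two smoothed copies of \<open>h\<close> plus the constant 2
    e. As each copy is off by at most \<open>e\<close>, the constant lifts the sum above the support
    function of \<open>D\<close>.\<close>
  define a where "a n = of_real (fejer_weight N n) * c n * (1 + cis (of_int n * (pi - \<theta>))) + (if n = 0 then of_real (2 * e) else 0)" for n
  define p where "p t = Re (trig_poly a N t)" for t
  define p1 where "p1 t = Re (trig_poly (\<lambda>n. \<i> * of_int n * a n) N t)" for t
  define p2 where "p2 t = Re (trig_poly (\<lambda>n. \<i> * of_int n * (\<i> * of_int n * a n)) N t)" for t
  have p_sum: "p t = \<sigma> t + \<sigma> (t - \<theta> + pi) + 2 * e" for t
  proof -
    have cis: "cis (of_int n * (t - \<theta> + pi)) = cis (of_int n * t) * cis (of_int n * (pi - \<theta>))" for n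
      by (simp add: cis_mult algebra_simps)
    have "trig_poly a N t = (\<Sum>n\<in>{-int N..int N}. of_real (fejer_weight N n) * c n * cis (of_int n * t)
        + of_real (fejer_weight N n) * c n * cis (of_int n * (t - \<theta> + pi)) + (if n = 0 then of_real (2 * e) else 0))"
      unfolding trig_poly_def a_def cis by (intro sum.cong refl) (simp add: algebra_simps)
    also have "\<dots> = fejer_sum h N t + fejer_sum h N (t - \<theta> + pi) + of_real (2 * e)"
      unfolding fejer_sum_def c_def sum.distrib by (subst sum.delta) auto
    finally show ?thesis by (simp add: p_def \<sigma>_def)
  qed
  have p_deriv: "(p has_real_derivative p1 t) (at t)" "(p1 has_real_derivative p2 t) (at t)" for t
    unfolding p_def[abs_def] p1_def[abs_def] p2_def by (rule trig_poly_deriv)+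
  have p_pos: "p t + p2 t > 0" for t
  proof -
    \<comment> \<open>The Fejer means alone give only a weak inequality; the summand 2 e makes the
      radius of curvature strictly positive, as the locale requires.\<close>
    define q where "q t = p t - 2 * e" for t
    have "q t + p2 t \<ge> 0"
    proof (rule nonneg_of_second_difference[where f = q and ?f1.0 = p1 and t = t])
      show "(q has_real_derivative p1 t) (at t)" for t
        using DERIV_diff[OF p_deriv(1) DERIV_const] by (simp add: q_def[abs_def])
      show "2 * cos d * q t \<le> q (t + d) + q (t - d)" for d
        using \<sigma>_diff[of d t] \<sigma>_diff[of d "t - \<theta> + pi"] by (simp add: q_def p_sum algebra_simps)
    qed (rule p_deriv)
    then show ?thesis using e by (simp add: q_def)
  qed
  interpret smooth: smooth_support p p1 p2
  proof
    show "continuous_on UNIV p2"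
      unfolding p2_def[abs_def] by (intro continuous_intros continuous_on_trig_poly)
    show "p (t + 2 * pi) = p t" for t by (simp add: p_def trig_poly_periodic)
  qed (rule p_deriv p_pos)+
  have c_cnj: "c (- n) = cnj (c n)" for n unfolding c_def by (rule fourier_coeff_uminus)
  have a_cnj: "a (- n) = cnj (a n)" for n
    by (simp add: a_def c_cnj cis_cnj)
  have real: "trig_poly a N t = of_real (p t)"
    "trig_poly (\<lambda>n. of_real (1 - of_int n ^ 2) * a n) N t = of_real (p t + p2 t)" for t
  proof -
    show "trig_poly a N t = of_real (p t)" unfolding p_def by (rule trig_poly_real) (rule a_cnj)
    have "trig_poly (\<lambda>n. of_real (1 - of_int n ^ 2) * a n) N t
        = of_real (Re (trig_poly (\<lambda>n. of_real (1 - of_int n ^ 2) * a n) N t))"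
      by (rule trig_poly_real) (simp add: a_cnj)
    also have "Re (trig_poly (\<lambda>n. of_real (1 - of_int n ^ 2) * a n) N t) = p t + p2 t"
      unfolding p_def p2_def trig_poly_def plus_complex.sel(1)[symmetric] sum.distrib[symmetric]
      by (intro arg_cong[where f = Re] sum.cong refl) (simp add: algebra_simps power2_eq_square)
    finally show "trig_poly (\<lambda>n. of_real (1 - of_int n ^ 2) * a n) N t = of_real (p t + p2 t)" .
  qed
  \<comment> \<open>Parseval's identity: the conjugate is hidden in
    \<open>a (- n) = cnj (a n)\<close>, and the multiplier 1 - n^2 comes from p + p''.\<close>
  have "((\<lambda>t. complex_of_real (p t * (p t + p2 t))) has_integral
      (of_real (2 * pi) * (\<Sum>n\<in>{-int N..int N}. a (- n) * (of_real (1 - of_int n ^ 2) * a n)))) {0..2 * pi}"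
    using has_integral_trig_poly_mult[of a N "\<lambda>n. of_real (1 - of_int n ^ 2) * a n"] unfolding real by simp
  moreover have "((\<lambda>t. complex_of_real (p t * (p t + p2 t))) has_integral of_real (2 * measure lebesgue (wulff p))) {0..2 * pi}"
    using smooth.area_wulff by (rule has_integral_of_real)
  ultimately have "complex_of_real (2 * measure lebesgue (wulff p))
      = of_real (2 * pi) * (\<Sum>n\<in>{-int N..int N}. a (- n) * (of_real (1 - of_int n ^ 2) * a n))"
    by (rule has_integral_unique[rotated])
  also have "(\<Sum>n\<in>{-int N..int N}. a (- n) * (of_real (1 - of_int n ^ 2) * a n))
      = of_real (\<Sum>n\<in>{-int N..int N}. (1 - of_int n ^ 2) * (cmod (a n))\<^sup>2)"
    unfolding of_real_sum of_real_mult complex_norm_square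
    by (intro sum.cong refl) (simp add: a_cnj mult_ac)
  finally have "complex_of_real (2 * measure lebesgue (wulff p))
      = of_real (2 * (pi * (\<Sum>n\<in>{-int N..int N}. (1 - of_int n ^ 2) * (cmod (a n))\<^sup>2)))"
    by simp
  then have area: "measure lebesgue (wulff p) = pi * (\<Sum>n\<in>{-int N..int N}. (1 - of_int n ^ 2) * (cmod (a n))\<^sup>2)"
    unfolding of_real_eq_iff by simp
  \<comment> \<open>At n = 0 the added constant enters the square: (2 c0 + 2 e)^2 - 4 c0^2 = 8 e c0
    + 4 e^2, which is the correction in \<open>S\<close> up to the factor \<pi>.\<close>
  have a_norm: "(1 - of_int n ^ 2) * (cmod (a n))\<^sup>2 =
      (1 - of_int n ^ 2) * (fejer_weight N n * cmod (c n))\<^sup>2 * (2 + 2 * cos (of_int n * (\<theta> - pi)))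
      + (if n = 0 then 8 * e * Re (c 0) + 4 * e\<^sup>2 else 0)" for n
  proof (cases "n = 0")
    case True
    have c0: "c 0 = of_real (Re (c 0))" unfolding c_def by (rule fourier_coeff_zero_real)
    have "a 0 = of_real (2 * Re (c 0) + 2 * e)"
      unfolding a_def by (subst c0) simp
    then have "(cmod (a 0))\<^sup>2 = (2 * Re (c 0) + 2 * e)\<^sup>2" by (simp only: norm_of_real power2_abs)
    moreover have "(cmod (c 0))\<^sup>2 = (Re (c 0))\<^sup>2" by (subst c0) (simp only: norm_of_real power2_abs)
    ultimately show ?thesis using True by (simp add: power2_eq_square algebra_simps)
  next
    case False
    have "(cmod (1 + cis (of_int n * (pi - \<theta>))))\<^sup>2 = 2 + 2 * cos (of_int n * (\<theta> - pi))"
    proof -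
      have "(cmod (1 + cis x))\<^sup>2 = 2 + 2 * cos (- x)" for x
        unfolding cmod_power2 using sin_cos_squared_add[of x] by (simp add: power2_eq_square algebra_simps)
      from this[of "of_int n * (pi - \<theta>)"] show ?thesis by (simp add: algebra_simps)
    qed
    then show ?thesis using False by (simp add: a_def norm_mult power_mult_distrib)
  qed
  have wulff_area: "measure lebesgue (wulff p) = S"
    unfolding area a_norm sum.distrib S_def area_partial_sum_def
    by (subst sum.delta) (auto simp: c_def h_def algebra_simps)
  have A: "A = measure lebesgue D" by (simp add: A_def D_def excluded_area_eq)
  have h_ge: "h t \<ge> r" for t
  proof (rule dense_le_bounded[of 0])
    fix s assume s: "0 < s" "s < r"
    then have "s *\<^sub>R unit_dir t \<in> M" using ball by (auto simp: subset_iff)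
    then have "unit_dir t \<bullet> (s *\<^sub>R unit_dir t) \<le> h t" unfolding h_def by (rule support_fun_upper[OF M])
    then show "s \<le> h t" by (simp add: dot_square_norm)
  qed (rule ball)
  have lower: "support_fun D t \<le> p t" for t
    using \<sigma>_approx[of t] \<sigma>_approx[of "t - \<theta> + pi"] unfolding hD p_sum by linarith
  \<comment> \<open>The additive error 4 e becomes a factor because the support function of
    \<open>D\<close> is at least 2 r. A factor corresponds to a homothety, whose effect on the area
    is known.\<close>
  have upper: "p t \<le> (1 + 2 * e / r) * support_fun D t" for t
  proof -
    have "p t \<le> support_fun D t + 4 * e"
      using \<sigma>_approx[of t] \<sigma>_approx[of "t - \<theta> + pi"] unfolding hD p_sum by linarith
    also have "4 * e = 2 * e / r * (2 * r)" using ball by simp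
    also have "2 * e / r * (2 * r) \<le> 2 * e / r * support_fun D t"
      using h_ge[of t] h_ge[of "t - \<theta> + pi"] ball e by (intro mult_left_mono) (auto simp: hD)
    finally show ?thesis by (simp add: algebra_simps)
  qed
  have p_le: "p t \<le> 2 * R + 4 * e" for t
  proof -
    have "h t \<le> R" for t
    proof -
      obtain x where x: "x \<in> M" "support_fun M t = unit_dir t \<bullet> x"
        using support_fun_attained M by blast
      show ?thesis using norm_cauchy_schwarz[of "unit_dir t" x] R(1)[OF x(1)] by (simp add: h_def x)
    qed
    from this[of t] this[of "t - \<theta> + pi"] show ?thesis
      using \<sigma>_approx[of t] \<sigma>_approx[of "t - \<theta> + pi"] unfolding p_sum by linarith
  qed
  have meas: "wulff p \<in> lmeasurable" using p_le by (intro lmeasurable_compact compact_wulff)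
  have "D \<subseteq> wulff p"
    by (subst convex_body_eq_wulff[OF D]) (rule wulff_mono, rule lower)
  then show "A \<le> S"
    unfolding A wulff_area[symmetric] using convex_body_measurable[OF D] meas
    by (intro measure_mono_fmeasurable) auto
  have pos: "1 + 2 * e / r > 0" using e ball by (simp add: add_pos_pos)
  have "wulff p \<subseteq> (\<lambda>x. (1 + 2 * e / r) *\<^sub>R x) ` D"
  proof -
    have "wulff p \<subseteq> wulff (\<lambda>t. (1 + 2 * e / r) * support_fun D t)"
      using upper by (rule wulff_mono)
    also have "\<dots> = (\<lambda>x. (1 + 2 * e / r) *\<^sub>R x) ` D"
      unfolding wulff_scale[OF pos] convex_body_eq_wulff[OF D, symmetric] ..
    finally show ?thesis .
  qed
  moreover have "compact ((\<lambda>x. (1 + 2 * e / r) *\<^sub>R x) ` D)"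
    using D by (intro compact_scaling) (simp add: convex_body_def)
  ultimately have "S \<le> measure lebesgue ((\<lambda>x. (1 + 2 * e / r) *\<^sub>R x) ` D)"
    unfolding wulff_area[symmetric] using meas
    by (intro measure_mono_fmeasurable lmeasurable_compact) auto
  also have "\<dots> = (1 + 2 * e / r)\<^sup>2 * A"
    using measure_lebesgue_affine[of "1 + 2 * e / r" 0 D] pos by (simp add: A)
  finally show "S \<le> (1 + 2 * e / r)\<^sup>2 * A" .
qed

section \<open>The excluded area determines the Fourier moduli\<close>

text \<open>The two area bounds confine the partial sum up to errors that depend on \<theta> only
  through the excluded area itself, and this is at most the area of the disc of radius 2 R, which
  contains every \<open>rot_difference M \<theta>\<close>.\<close>

lemma excluded_area_uniform_limit_0:
  assumes M: "convex_body M" and "ball 0 r \<subseteq> M" "r > 0"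
  shows "uniform_limit UNIV (area_partial_sum (fourier_coeff (support_fun M))) (excluded_area M) sequentially"
proof -
  obtain R where R: "\<And>x. x \<in> M \<Longrightarrow> norm x \<le> R" "R > 0" using convex_body_norm_bound[OF M] by blast
  define B where "B = measure lebesgue (cball (0::real^2) (2 * R))"
  define c0 where "c0 = Re (fourier_coeff (support_fun M) 0)"
  define e where "e N = 5 * R / (2 * sqrt (real N + 1))" for N :: nat
  have e_pos: "e N > 0" for N using R by (simp add: e_def)
  define g where "g N = ((1 + 2 * e N / r)\<^sup>2 - 1) * B + pi * (8 * e N * \<bar>c0\<bar> + 4 * (e N)\<^sup>2)" for N
  have e_lim: "e \<longlonglongrightarrow> 0" unfolding e_def by real_asymp
  have "g \<longlonglongrightarrow> ((1 + 2 * 0 / r)\<^sup>2 - 1) * B + pi * (8 * 0 * \<bar>c0\<bar> + 4 * 0\<^sup>2)"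
    unfolding g_def[abs_def] by (intro tendsto_intros e_lim) (use assms in auto)
  then have g_lim: "g \<longlonglongrightarrow> 0" by simp
  have bound: "\<bar>area_partial_sum (fourier_coeff (support_fun M)) N \<theta> - excluded_area M \<theta>\<bar> \<le> g N" for N \<theta>
  proof -
    define S where "S = area_partial_sum (fourier_coeff (support_fun M)) N \<theta>"
    define A where "A = excluded_area M \<theta>"
    have est: "A \<le> S + pi * (8 * e N * c0 + 4 * (e N)\<^sup>2)"
      "S + pi * (8 * e N * c0 + 4 * (e N)\<^sup>2) \<le> (1 + 2 * e N / r)\<^sup>2 * A"
      unfolding A_def S_def c0_def
      using rot_difference_area_estimate[where N = N and \<theta> = \<theta>, OF M assms(2,3) R e_def] by simp_all
    have "rot_difference M \<theta> \<subseteq> cball 0 (2 * R)"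
    proof
      fix z assume "z \<in> rot_difference M \<theta>"
      then obtain a b where z: "z = a - rot \<theta> *v b" "a \<in> M" "b \<in> M" by (auto simp: rot_difference_alt)
      have "(norm (rot \<theta> *v b))\<^sup>2 = (norm b)\<^sup>2 * ((sin \<theta>)\<^sup>2 + (cos \<theta>)\<^sup>2)"
        unfolding power2_norm_eq_inner inner_vec_def sum_2 rot_nth inner_real_def by algebra
      then have "norm (rot \<theta> *v b) = norm b" by (simp add: power2_eq_iff_nonneg)
      then show "z \<in> cball 0 (2 * R)"
        using norm_triangle_ineq4[of a "rot \<theta> *v b"] R(1)[OF z(2)] R(1)[OF z(3)] by (simp add: z)
    qed
    then have "A \<le> B"
      unfolding A_def B_def excluded_area_eq using convex_body_measurable[OF convex_body_rot_difference[OF M]]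
      by (intro measure_mono_fmeasurable) auto
    then have "((1 + 2 * e N / r)\<^sup>2 - 1) * A \<le> ((1 + 2 * e N / r)\<^sup>2 - 1) * B"
      using e_pos[of N] assms by (intro mult_left_mono) auto
    moreover have "A \<ge> 0" by (simp add: A_def excluded_area_def)
    moreover have "0 \<le> ((1 + 2 * e N / r)\<^sup>2 - 1) * B"
      using e_pos[of N] assms by (intro mult_nonneg_nonneg) (auto simp: B_def)
    moreover have "\<bar>pi * (8 * e N * c0 + 4 * (e N)\<^sup>2)\<bar> \<le> pi * (8 * e N * \<bar>c0\<bar> + 4 * (e N)\<^sup>2)"
      using e_pos[of N] abs_triangle_ineq[of "8 * e N * c0" "4 * (e N)\<^sup>2"] by (simp add: abs_mult)
    ultimately have "\<bar>S - A\<bar> \<le> g N"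
      using est unfolding g_def left_diff_distrib by linarith
    then show ?thesis by (simp add: S_def A_def)
  qed
  show ?thesis
  proof (rule uniform_limitI)
    fix \<epsilon> :: real assume "\<epsilon> > 0"
    then have "\<forall>\<^sub>F N in sequentially. g N < \<epsilon>" using g_lim by (intro order_tendstoD)
    then show "\<forall>\<^sub>F N in sequentially. \<forall>\<theta>\<in>UNIV. dist (area_partial_sum (fourier_coeff (support_fun M)) N \<theta>) (excluded_area M \<theta>) < \<epsilon>"
      by eventually_elim (use bound in \<open>auto simp: dist_real_def intro: le_less_trans\<close>)
  qed
qed

text \<open>A translation by \<open>b\<close> adds this function to a support function, so it moves
  only the coefficients n = 1 and n = -1. The signs come from writing b1 cos t + b2 sin t as the
  real part of (b1 - i b2) e^(i t).\<close>

lemma fourier_coeff_unit_dir_inner: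
  "fourier_coeff (\<lambda>t. unit_dir t \<bullet> b) n =
     (if n = 1 then Complex (b$1 / 2) (- b$2 / 2) else 0) + (if n = - 1 then Complex (b$1 / 2) (b$2 / 2) else 0)"
proof -
  have "unit_dir t \<bullet> b = 2 * Re (Complex (b$1 / 2) (- b$2 / 2) * cis (of_int 1 * t))" for t
    by (simp add: inner_unit_dir mult.commute)
  then show ?thesis
    by (simp only: fourier_coeff_trig_monomial) (simp add: complex_eq_iff)
qed

lemma fourier_coeff_affine_image:
  assumes "convex_body M"
  shows "fourier_coeff (support_fun ((\<lambda>x. rot \<alpha> *v x + b) ` M)) n = cis (- (of_int n * \<alpha>)) * fourier_coeff (support_fun M) n
     + (if n = 1 then Complex (b$1 / 2) (- b$2 / 2) else 0) + (if n = - 1 then Complex (b$1 / 2) (b$2 / 2) else 0)"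
proof -
  have c: "continuous_on UNIV (\<lambda>t. support_fun M (t + - \<alpha>))"
    by (rule continuous_on_compose2[OF continuous_on_support_fun[OF assms, of UNIV]]) (auto intro!: continuous_intros)
  have "support_fun ((\<lambda>x. rot \<alpha> *v x + b) ` M) = (\<lambda>t. support_fun M (t + - \<alpha>) + unit_dir t \<bullet> b)"
    using support_fun_affine_image[OF assms] by auto
  then have "fourier_coeff (support_fun ((\<lambda>x. rot \<alpha> *v x + b) ` M)) n
     = fourier_coeff (\<lambda>t. support_fun M (t + - \<alpha>)) n + fourier_coeff (\<lambda>t. unit_dir t \<bullet> b) n"
    using c by (simp only:) (intro fourier_coeff_add continuous_intros)
  also have "fourier_coeff (\<lambda>t. support_fun M (t + - \<alpha>)) n = cis (of_int n * - \<alpha>) * fourier_coeff (support_fun M) n"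
    by (rule fourier_coeff_shift[OF continuous_on_support_fun[OF assms]]) simp
  finally show ?thesis by (simp add: fourier_coeff_unit_dir_inner add.assoc)
qed

lemma rot_0 [simp]: "rot 0 *v x = x"
  by (simp add: vec_eq_iff forall_2 rot_nth)

lemma translate_eq_affine: "(\<lambda>x. rot 0 *v x + b) ` M = (+) b ` M"
  by (auto simp: add.commute)

text \<open>The factor 1 - n^2 vanishes at the two excluded indices.\<close>

lemma area_partial_sum_cong:
  assumes "\<And>n. n \<noteq> 1 \<Longrightarrow> n \<noteq> - 1 \<Longrightarrow> cmod (c n) = cmod (c' n)"
  shows "area_partial_sum c N \<theta> = area_partial_sum c' N \<theta>"
  unfolding area_partial_sum_def
proof (rule arg_cong[where f = "\<lambda>s. pi * s"], rule sum.cong, rule refl)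
  fix n :: int
  show "(1 - of_int n ^ 2) * (fejer_weight N n * cmod (c n))\<^sup>2 * (2 + 2 * cos (of_int n * (\<theta> - pi)))
      = (1 - of_int n ^ 2) * (fejer_weight N n * cmod (c' n))\<^sup>2 * (2 + 2 * cos (of_int n * (\<theta> - pi)))"
    using assms[of n] by (cases "n = 1 \<or> n = - 1") auto
qed

text \<open>Translating an interior point to the origin changes neither the excluded area nor the
  partial sums, in which the affected coefficients have factor 0.\<close>

lemma excluded_area_uniform_limit:
  assumes M: "convex_body M" and "interior M \<noteq> {}"
  shows "uniform_limit UNIV (area_partial_sum (fourier_coeff (support_fun M))) (excluded_area M) sequentially"
proof -
  obtain x r where x: "r > 0" "ball x r \<subseteq> M"
    using assms(2) by (metis ex_in_conv mem_interior)
  define M0 where "M0 = (+) (- x) ` M"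
  have "y \<in> M0" if "y \<in> ball 0 r" for y
  proof -
    have "x + y \<in> M" using x that by (auto simp: subset_iff dist_norm)
    then show ?thesis unfolding M0_def by (intro image_eqI[of _ _ "x + y"]) auto
  qed
  then have "ball 0 r \<subseteq> M0" by blast
  moreover have "convex_body M0"
    unfolding M0_def translate_eq_affine[symmetric] by (rule convex_body_affine_image[OF M])
  moreover have "excluded_area M0 = excluded_area M" unfolding M0_def by (rule excluded_area_translate)
  moreover have "area_partial_sum (fourier_coeff (support_fun M0)) = area_partial_sum (fourier_coeff (support_fun M))"
    unfolding M0_def translate_eq_affine[symmetric]
    by (intro ext area_partial_sum_cong) (simp only: fourier_coeff_affine_image[OF M], simp add: norm_mult)
  ultimately show ?thesis using excluded_area_uniform_limit_0[of M0 r] x by simp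
qed

section \<open>Recovering the Fourier moduli from the excluded area\<close>

lemma has_integral_cos_shift:
  "((\<lambda>t. cos (of_int k * (t - s))) has_integral (if k = 0 then 2 * pi else 0)) {0..2 * pi}"
proof -
  have "((\<lambda>t. cis (- (of_int k * s)) * cis (of_int k * t)) has_integral
      (cis (- (of_int k * s)) * (if k = 0 then of_real (2 * pi) else 0))) {0..0 + 2 * pi}"
    by (intro has_integral_mult_right has_integral_cis)
  from has_integral_linear[OF this bounded_linear_Re]
  show ?thesis by (auto simp: o_def cis_mult algebra_simps)
qed

lemma has_integral_cos_cos_shift:
  assumes "m \<noteq> 0"
  shows "((\<lambda>t. (2 + 2 * cos (of_int n * (t - s))) * cos (of_int m * (t - s))) has_integral
     (if n = m then 2 * pi else 0) + (if n = - m then 2 * pi else 0)) {0..2 * pi}"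
proof -
  have "(2 + 2 * cos (of_int n * (t - s))) * cos (of_int m * (t - s)) = 2 * cos (of_int m * (t - s)) +
     (cos (of_int (n - m) * (t - s)) + cos (of_int (n + m) * (t - s)))" for t
    unfolding of_int_diff of_int_add distrib_right[of "real_of_int n"] left_diff_distrib[of "real_of_int n"]
      cos_add cos_diff by algebra
  moreover have "((\<lambda>t. 2 * cos (of_int m * (t - s)) +
     (cos (of_int (n - m) * (t - s)) + cos (of_int (n + m) * (t - s)))) has_integral
     (2 * (if m = 0 then 2 * pi else 0) + ((if n - m = 0 then 2 * pi else 0) + (if n + m = 0 then 2 * pi else 0)))) {0..2 * pi}"
    by (intro has_integral_add has_integral_mult_right has_integral_cos_shift)
  moreover have "n + m = 0 \<longleftrightarrow> n = - m" by auto
  ultimately show ?thesis using assms by simp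
qed

text \<open>Uniform convergence allows integration term by term. Only n = m and n = -m survive, each
  contributing 2 \<pi>, and the factor \<pi> of the partial sums completes the constant.\<close>

lemma excluded_area_cos_coefficient:
  assumes M: "convex_body M" "interior M \<noteq> {}" and m: "m > 0"
  shows "((\<lambda>\<theta>. excluded_area M \<theta> * cos (of_int m * (\<theta> - pi))) has_integral
     4 * pi\<^sup>2 * (1 - of_int m ^ 2) * (cmod (fourier_coeff (support_fun M) m))\<^sup>2) {0..2 * pi}"
proof -
  define c where "c = fourier_coeff (support_fun M)"
  have "uniform_limit {0..2 * pi} (\<lambda>N \<theta>. area_partial_sum c N \<theta> * cos (of_int m * (\<theta> - pi)))
      (\<lambda>\<theta>. excluded_area M \<theta> * cos (of_int m * (\<theta> - pi))) sequentially"
  proof (rule uniform_limitI)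
    fix \<epsilon> :: real assume "\<epsilon> > 0"
    then have "\<forall>\<^sub>F N in sequentially. \<forall>\<theta>\<in>UNIV. dist (area_partial_sum c N \<theta>) (excluded_area M \<theta>) < \<epsilon>"
      unfolding c_def by (intro uniform_limitD excluded_area_uniform_limit M)
    then show "\<forall>\<^sub>F N in sequentially. \<forall>\<theta>\<in>{0..2 * pi}. dist (area_partial_sum c N \<theta> * cos (of_int m * (\<theta> - pi)))
         (excluded_area M \<theta> * cos (of_int m * (\<theta> - pi))) < \<epsilon>"
    proof eventually_elim
      case (elim N)
      have "\<bar>x * cos z - y * cos z\<bar> \<le> \<bar>x - y\<bar>" for x y z :: real
        unfolding left_diff_distrib[symmetric] abs_mult by (rule mult_left_le) auto
      moreover have "\<bar>area_partial_sum c N \<theta> - excluded_area M \<theta>\<bar> < \<epsilon>" for \<theta>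
        using elim by (simp add: dist_real_def)
      ultimately show ?case unfolding dist_real_def by (blast intro: le_less_trans)
    qed
  qed
  moreover have "continuous_on {0..2 * pi} (\<lambda>\<theta>. area_partial_sum c N \<theta> * cos (of_int m * (\<theta> - pi)))" for N
    unfolding area_partial_sum_def by (intro continuous_intros)
  ultimately obtain I J where IJ: "\<And>N. ((\<lambda>\<theta>. area_partial_sum c N \<theta> * cos (of_int m * (\<theta> - pi))) has_integral I N) {0..2 * pi}"
    "((\<lambda>\<theta>. excluded_area M \<theta> * cos (of_int m * (\<theta> - pi))) has_integral J) {0..2 * pi}" "I \<longlonglongrightarrow> J"
    by (rule uniform_limit_integral) auto
  \<comment> \<open>From N >= m on, the partial sum contains both surviving indices; the integral
    still carries the squared Fejer weight, which tends to 1.\<close>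
  have I: "I N = 4 * pi\<^sup>2 * (1 - of_int m ^ 2) * (fejer_weight N m * cmod (c m))\<^sup>2" if N: "m \<le> int N" for N
  proof -
    define k where "k n = (1 - of_int n ^ 2) * (fejer_weight N n * cmod (c n))\<^sup>2" for n
    have k: "k (- n) = k n" for n
      by (simp add: k_def c_def fourier_coeff_uminus)
    have "((\<lambda>\<theta>. pi * (\<Sum>n\<in>{-int N..int N}. k n * ((2 + 2 * cos (of_int n * (\<theta> - pi))) * cos (of_int m * (\<theta> - pi))))) has_integral
        pi * (\<Sum>n\<in>{-int N..int N}. k n * ((if n = m then 2 * pi else 0) + (if n = - m then 2 * pi else 0)))) {0..2 * pi}"
      using m by (intro has_integral_mult_right has_integral_sum has_integral_cos_cos_shift) auto
    moreover have "pi * (\<Sum>n\<in>{-int N..int N}. k n * ((2 + 2 * cos (of_int n * (\<theta> - pi))) * cos (of_int m * (\<theta> - pi))))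
        = area_partial_sum c N \<theta> * cos (of_int m * (\<theta> - pi))" for \<theta>
      by (simp add: area_partial_sum_def k_def sum_distrib_left mult_ac)
    ultimately have "I N = pi * (\<Sum>n\<in>{-int N..int N}. k n * ((if n = m then 2 * pi else 0) + (if n = - m then 2 * pi else 0)))"
      using IJ(1)[of N] by (auto intro: has_integral_unique)
    also have "(\<Sum>n\<in>{-int N..int N}. k n * ((if n = m then 2 * pi else 0) + (if n = - m then 2 * pi else 0)))
        = (\<Sum>n\<in>{-int N..int N}. if n = m then 2 * pi * k m else 0) + (\<Sum>n\<in>{-int N..int N}. if n = - m then 2 * pi * k (- m) else 0)"
      unfolding sum.distrib[symmetric] by (intro sum.cong refl) auto
    also have "\<dots> = 2 * pi * k m + 2 * pi * k (- m)"
      using N m by (subst (1 2) sum.delta) auto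
    finally show ?thesis by (simp only: k) (simp add: k_def power2_eq_square)
  qed
  have "(\<lambda>N. 4 * pi\<^sup>2 * (1 - of_int m ^ 2) * (fejer_weight N m * cmod (c m))\<^sup>2) \<longlonglongrightarrow>
      4 * pi\<^sup>2 * (1 - of_int m ^ 2) * (1 * cmod (c m))\<^sup>2"
    by (intro tendsto_intros fejer_weight_tendsto)
  moreover have "\<forall>\<^sub>F N in sequentially. 4 * pi\<^sup>2 * (1 - of_int m ^ 2) * (fejer_weight N m * cmod (c m))\<^sup>2 = I N"
    using eventually_ge_at_top[of "nat m"] by eventually_elim (simp add: I)
  ultimately have "I \<longlonglongrightarrow> 4 * pi\<^sup>2 * (1 - of_int m ^ 2) * (1 * cmod (c m))\<^sup>2"
    by (rule Lim_transform_eventually)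
  then have "J = 4 * pi\<^sup>2 * (1 - of_int m ^ 2) * (cmod (c m))\<^sup>2"
    using IJ(3) LIMSEQ_unique by fastforce
  then show ?thesis using IJ(2) by (simp add: c_def)
qed

theorem excluded_area_eq_iff:
  assumes M: "convex_body M" "interior M \<noteq> {}" and M': "convex_body M'" "interior M' \<noteq> {}"
  shows "excluded_area M = excluded_area M' \<longleftrightarrow>
     (\<forall>n. n \<noteq> 1 \<longrightarrow> n \<noteq> - 1 \<longrightarrow> cmod (fourier_coeff (support_fun M) n) = cmod (fourier_coeff (support_fun M') n))"
    (is "?E \<longleftrightarrow> ?F")
proof
  assume F: ?F
  have "excluded_area M \<theta> = excluded_area M' \<theta>" for \<theta>
  proof (rule LIMSEQ_unique)
    show "(\<lambda>N. area_partial_sum (fourier_coeff (support_fun M)) N \<theta>) \<longlonglongrightarrow> excluded_area M \<theta>"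
      by (rule tendsto_uniform_limitI[OF excluded_area_uniform_limit[OF M]]) simp
    have "area_partial_sum (fourier_coeff (support_fun M)) N \<theta> = area_partial_sum (fourier_coeff (support_fun M')) N \<theta>" for N
      using F by (intro area_partial_sum_cong) auto
    then show "(\<lambda>N. area_partial_sum (fourier_coeff (support_fun M)) N \<theta>) \<longlonglongrightarrow> excluded_area M' \<theta>"
      using tendsto_uniform_limitI[OF excluded_area_uniform_limit[OF M'], of \<theta>] by simp
  qed
  then show ?E by blast
next
  assume E: ?E
  define c where "c = fourier_coeff (support_fun M)"
  define c' where "c' = fourier_coeff (support_fun M')"
  have pos: "cmod (c m) = cmod (c' m)" if m: "m \<ge> 2" for m
  proof -
    have "4 * pi\<^sup>2 * (1 - of_int m ^ 2) * (cmod (c m))\<^sup>2 = 4 * pi\<^sup>2 * (1 - of_int m ^ 2) * (cmod (c' m))\<^sup>2"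
      using has_integral_unique[OF excluded_area_cos_coefficient[OF M, of m, unfolded E]
          excluded_area_cos_coefficient[OF M', of m]] m
      unfolding c_def c'_def by simp
    moreover have "real_of_int m ^ 2 \<noteq> 1"
      using m by (simp add: power2_eq_1_iff)
    ultimately have "(cmod (c m))\<^sup>2 = (cmod (c' m))\<^sup>2" by simp
    then show ?thesis by (simp add: power2_eq_iff_nonneg)
  qed
  have nz: "cmod (c m) = cmod (c' m)" if "m \<noteq> 1" "m \<noteq> - 1" "m \<noteq> 0" for m
  proof (cases "m \<ge> 2")
    case False
    then have "cmod (c (- m)) = cmod (c' (- m))" using that by (intro pos) auto
    then show ?thesis by (simp add: c_def c'_def fourier_coeff_uminus)
  qed (rule pos)
  \<comment> \<open>No cosine with m > 0 detects the constant coefficient. At \<theta> = 0 all other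
    terms of the two partial sums coincide, so their difference is the constant \<open>d\<close>,
    and its limit is 0.\<close>
  have "cmod (c 0) = cmod (c' 0)"
  proof -
    define d where "d = 4 * pi * ((cmod (c 0))\<^sup>2 - (cmod (c' 0))\<^sup>2)"
    have "area_partial_sum c N 0 - area_partial_sum c' N 0 = d" for N
    proof -
      have "area_partial_sum c N 0 - area_partial_sum c' N 0
          = pi * (\<Sum>n\<in>{-int N..int N}. if n = 0 then 4 * ((cmod (c 0))\<^sup>2 - (cmod (c' 0))\<^sup>2) else 0)"
        unfolding area_partial_sum_def right_diff_distrib[symmetric] sum_subtractf[symmetric]
      proof (rule arg_cong[where f = "\<lambda>s. pi * s"], rule sum.cong, rule refl)
        fix n :: int
        show "(1 - of_int n ^ 2) * (fejer_weight N n * cmod (c n))\<^sup>2 * (2 + 2 * cos (of_int n * (0 - pi)))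
            - (1 - of_int n ^ 2) * (fejer_weight N n * cmod (c' n))\<^sup>2 * (2 + 2 * cos (of_int n * (0 - pi)))
            = (if n = 0 then 4 * ((cmod (c 0))\<^sup>2 - (cmod (c' 0))\<^sup>2) else 0)"
          using nz[of n] by (cases "n = 0"; cases "n = 1 \<or> n = - 1") auto
      qed
      also have "\<dots> = d" by (subst sum.delta) (auto simp: d_def)
      finally show ?thesis .
    qed
    moreover have "(\<lambda>N. area_partial_sum c N 0 - area_partial_sum c' N 0) \<longlonglongrightarrow> excluded_area M 0 - excluded_area M' 0"
      unfolding c_def c'_def
      by (intro tendsto_diff tendsto_uniform_limitI[OF excluded_area_uniform_limit] M M') auto
    ultimately have "d = 0" using E by (simp add: LIMSEQ_const_iff)
    then show ?thesis by (simp add: d_def power2_eq_iff_nonneg)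
  qed
  with nz show ?F unfolding c_def c'_def by metis
qed

section \<open>Recognising support functions\<close>

text \<open>A maximum principle. Up to the factor sin (r - l), \<open>g\<close> is \<open>f\<close>
  minus the sinusoid with the same end values, so it vanishes at \<open>l\<close> and
  \<open>r\<close>. If it were positive somewhere, g(x) / cos (x - m) would have a positive maximum
  \<open>K\<close> at an interior point, where the sinusoid K cos (x - m) touches \<open>g\<close>
  from above; the second difference of a sinusoid vanishes, against the strict inequality for
  \<open>f\<close>. Length below \<pi> keeps the cosine around the midpoint positive.\<close>

lemma trig_chord:
  fixes f :: "real \<Rightarrow> real"
  assumes cont: "continuous_on UNIV f"
    and diff: "\<And>t e. e > 0 \<Longrightarrow> \<exists>d. 0 < d \<and> d < e \<and> f (t + d) + f (t - d) > 2 * cos d * f t"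
    and lr: "l < r" "r - l < pi" and t: "t \<in> {l..r}"
  shows "f t * sin (r - l) \<le> f r * sin (t - l) + f l * sin (r - t)"
proof (rule ccontr)
  assume neg: "\<not> ?thesis"
  define m where "m = (l + r) / 2"
  define g where "g x = f x * sin (r - l) - f r * sin (x - l) - f l * sin (r - x)" for x
  have sin_pos: "sin (r - l) > 0" using lr by (intro sin_gt_zero) auto
  have cos_pos: "cos (x - m) > 0" if "x \<in> {l..r}" for x
    using that lr by (intro cos_gt_zero_pi) (auto simp: m_def field_simps)
  have "continuous_on {l..r} (\<lambda>x. g x / cos (x - m))"
    unfolding g_def using cos_pos
    by (intro continuous_intros continuous_on_subset[OF cont]) fastforce+
  moreover have "{l..r} \<noteq> {}" using lr by simp
  ultimately obtain x where x: "x \<in> {l..r}" "\<And>y. y \<in> {l..r} \<Longrightarrow> g y / cos (y - m) \<le> g x / cos (x - m)"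
    using continuous_attains_sup[of "{l..r}" "\<lambda>x. g x / cos (x - m)"] by (auto simp: Ball_def)
  define K where "K = g x / cos (x - m)"
  have "g t / cos (t - m) > 0" using neg cos_pos[OF t] by (simp add: g_def)
  then have K: "K > 0" using x(2)[OF t] by (simp add: K_def)
  have g_le: "g y \<le> K * cos (y - m)" if "y \<in> {l..r}" for y
    using x(2)[OF that] cos_pos[OF that] unfolding K_def[symmetric] by (simp add: divide_le_eq)
  have gx: "g x = K * cos (x - m)" using cos_pos[OF x(1)] by (simp add: K_def)
  have "g l = 0" "g r = 0" by (simp_all add: g_def)
  then have "x \<noteq> l" "x \<noteq> r" using K by (auto simp: K_def)
  then have "min (x - l) (r - x) > 0" using x(1) by auto
  then obtain d where d: "0 < d" "d < min (x - l) (r - x)" "f (x + d) + f (x - d) > 2 * cos d * f x"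
    using diff by blast
  have "g (x + d) + g (x - d) - 2 * cos d * g x = (f (x + d) + f (x - d) - 2 * cos d * f x) * sin (r - l)"
  proof -
    have e: "x + d - l = (x - l) + d" "x - d - l = (x - l) - d" "r - (x + d) = (r - x) - d" "r - (x - d) = (r - x) + d"
      by auto
    show ?thesis unfolding g_def e sin_add[of _ d] sin_diff[of _ d] by algebra
  qed
  moreover have "\<dots> > 0" using d sin_pos by simp
  moreover have "g (x + d) + g (x - d) - 2 * cos d * g x \<le> 0"
  proof -
    have "g (x + d) \<le> K * cos ((x - m) + d)" "g (x - d) \<le> K * cos ((x - m) - d)"
      using g_le[of "x + d"] g_le[of "x - d"] d by (simp_all add: algebra_simps)
    then have "g (x + d) + g (x - d) \<le> 2 * cos d * (K * cos (x - m))"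
      unfolding cos_add cos_diff by (simp add: algebra_simps)
    then show ?thesis by (simp add: gx)
  qed
  ultimately show False by linarith
qed

text \<open>The constraint for each \<open>t\<close> must be attained on \<open>wulff f\<close>. A
  candidate is f(t) u + b u' with u, u' the directions t and t + \<pi>/2; the constraints on the two
  sides of \<open>t\<close> then read L(v) <= b <= U(s), and such a \<open>b\<close> exists since
  every L(v) is below every U(s).\<close>

lemma support_fun_wulff:
  fixes f :: "real \<Rightarrow> real"
  assumes cont: "continuous_on UNIV f" and per: "\<And>t. f (t + 2 * pi) = f t"
    and diff: "\<And>t e. e > 0 \<Longrightarrow> \<exists>d. 0 < d \<and> d < e \<and> f (t + d) + f (t - d) > 2 * cos d * f t"
    and pos: "m > 0" "\<And>t. m \<le> f t" and bound: "\<And>t. f t \<le> B"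
  shows "convex_body (wulff f)" "support_fun (wulff f) = f" "interior (wulff f) \<noteq> {}"
proof -
  have f_pos: "f t > 0" for t using pos less_le_trans by blast
  have contact: "\<exists>x\<in>wulff f. unit_dir t \<bullet> x = f t" for t
  proof -
    define L where "L v = (f t * cos v - f (t - v)) / sin v" for v
    define U where "U s = (f (t + s) - f t * cos s) / sin s" for s
    have LU: "L v \<le> U s" if v: "v \<in> {0<..<pi}" and s: "s \<in> {0<..<pi}" for v s
    proof -
      have sin: "sin v > 0" "sin s > 0" using v s by (auto intro: sin_gt_zero)
      have "f t * sin (s + v) \<le> sin s * f (t - v) + sin v * f (t + s)"
      proof (cases "s + v < pi")
        case True
        then show ?thesis
          using trig_chord[OF cont diff, of "t - v" "t + s" t] v s by (simp add: mult_ac add_ac)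
      next
        \<comment> \<open>The two directions span at least a half turn, beyond the reach of
          \<open>trig_chord\<close>; here the left side is nonpositive and positivity of
          \<open>f\<close> suffices.\<close>
        case False
        then have "sin (s + v) \<le> 0" using v s by (cases "s + v = pi") (auto intro!: less_imp_le sin_lt_zero)
        then have "f t * sin (s + v) \<le> 0" using f_pos[of t] by (intro mult_nonneg_nonpos) auto
        also have "0 \<le> sin s * f (t - v) + sin v * f (t + s)"
          using sin f_pos[of "t - v"] f_pos[of "t + s"] by (intro add_nonneg_nonneg mult_nonneg_nonneg) auto
        finally show ?thesis .
      qed
      then have "(f t * cos v - f (t - v)) * sin s \<le> (f (t + s) - f t * cos s) * sin v"
        by (simp add: sin_add algebra_simps)
      then show ?thesis
        using sin unfolding L_def U_def by (simp add: divide_le_eq pos_le_divide_eq)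
    qed
    \<comment> \<open>Any number between the lower and the upper bounds would do; the supremum is
      finite because each U(s) bounds all L(v).\<close>
    define b where "b = (SUP v\<in>{0<..<pi}. L v)"
    have "pi / 2 \<in> {0<..<pi}" by simp
    then have L_le: "L v \<le> b" if "v \<in> {0<..<pi}" for v
      unfolding b_def using that LU by (intro cSUP_upper bdd_aboveI2) auto
    have le_U: "b \<le> U s" if "s \<in> {0<..<pi}" for s
      unfolding b_def using that LU \<open>pi / 2 \<in> _\<close> by (intro cSUP_least) auto
    define x where "x = f t *\<^sub>R unit_dir t + b *\<^sub>R unit_dir (t + pi / 2)"
    have inner_x: "unit_dir (t + s) \<bullet> x = f t * cos s + b * sin s" for s
    proof -
      have "unit_dir (t + s) \<bullet> x = (f t * cos s + b * sin s) * ((sin t)\<^sup>2 + (cos t)\<^sup>2)"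

        by (simp only: inner_unit_dir x_def vector_add_component vector_scaleR_component real_scaleR_def
            unit_dir_nth sin_add cos_add sin_pi_half cos_pi_half) algebra
      then show ?thesis by simp
    qed
    have near: "f t * cos s + b * sin s \<le> f (t + s)" if "\<bar>s\<bar> \<le> pi" for s
    proof -
      have "s = 0 \<or> s = pi \<or> s = - pi \<or> (0 < s \<and> s < pi) \<or> (0 < - s \<and> - s < pi)"
        using that by linarith
      then consider "s = 0" | "s = pi" | "s = - pi" | "s \<in> {0<..<pi}" | "- s \<in> {0<..<pi}"
        by fastforce
      then show ?thesis
      proof cases
        case 4
        then have "b * sin s \<le> f (t + s) - f t * cos s"
          using le_U[OF 4] sin_gt_zero[of s] by (simp add: U_def pos_le_divide_eq)
        then show ?thesis by simp
      next
        case 5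
        then obtain v where v: "s = - v" "v \<in> {0<..<pi}" by (metis greaterThanLessThan_iff minus_minus)
        then have "f t * cos v - f (t - v) \<le> b * sin v"
          using L_le[OF v(2)] sin_gt_zero[of v] by (simp add: L_def pos_divide_le_eq)
        then show ?thesis by (simp add: v(1))
      qed (use f_pos[of t] f_pos[of "t + pi"] f_pos[of "t - pi"] in auto)
    qed
    have "unit_dir s \<bullet> x \<le> f s" for s
    proof -
      interpret f: periodic_fun_simple f "2 * pi" by unfold_locales (rule per)
      interpret u: periodic_fun_simple unit_dir "2 * pi" by unfold_locales simp
      obtain r k where r: "\<bar>r\<bar> \<le> pi" "s = t + r + of_int k * (2 * pi)"
        by (rule angle_reduction)
      have "unit_dir s \<bullet> x = unit_dir (t + r) \<bullet> x" "f s = f (t + r)"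
        unfolding r(2) by (simp_all only: f.plus_of_int u.plus_of_int)
      then show ?thesis using near[OF r(1)] by (simp add: inner_x)
    qed
    then have "x \<in> wulff f" by (simp add: wulff_def)
    moreover have "unit_dir t \<bullet> x = f t" using inner_x[of 0] by simp
    ultimately show ?thesis by blast
  qed
  show "convex_body (wulff f)"
    unfolding convex_body_def using contact compact_wulff[of f, OF bound] convex_closed_wulff by blast
  show "support_fun (wulff f) = f"
  proof
    fix t
    obtain x where "x \<in> wulff f" "unit_dir t \<bullet> x = f t" using contact by blast
    then show "support_fun (wulff f) t = f t"
      by (rule support_fun_eqI) (simp add: wulff_def)
  qed
  have "ball 0 m \<subseteq> wulff f"
  proof
    fix x :: "real^2" assume "x \<in> ball 0 m"
    then have "unit_dir t \<bullet> x \<le> f t" for t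
      using norm_cauchy_schwarz[of "unit_dir t" x] pos(2)[of t] by simp
    then show "x \<in> wulff f" by (simp add: wulff_def)
  qed
  then show "interior (wulff f) \<noteq> {}"
    using pos(1) by (metis centre_in_ball empty_iff mem_interior)
qed

section \<open>Rigid motions, bodies without interior, and congruence\<close>

lemma rotation_matrix_rot: "rotation_matrix (rot \<alpha>)"
proof -
  have "sin \<alpha> * sin \<alpha> + cos \<alpha> * cos \<alpha> = 1"
    by (metis add.commute sin_cos_squared_add3)
  then show ?thesis
    unfolding rotation_matrix_def orthogonal_matrix_def
    by (simp add: rot_def det_2 matrix_matrix_mult_def transpose_def mat_def vec_eq_iff forall_2 sum_2 vector_2)
qed

lemma rotation_matrix_2D:
  fixes Q :: "real^2^2"
  assumes "rotation_matrix Q"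
  obtains \<alpha> where "Q = rot \<alpha>"
proof -
  have orth: "transpose Q ** Q = mat 1" and det: "Q$1$1 * Q$2$2 - Q$1$2 * Q$2$1 = 1"
    using assms by (auto simp: rotation_matrix_def orthogonal_matrix_def det_2)
  have cols: "Q$1$1 * Q$1$1 + Q$2$1 * Q$2$1 = 1" "Q$1$2 * Q$1$2 + Q$2$2 * Q$2$2 = 1"
    using orth by (auto simp: matrix_matrix_mult_def transpose_def mat_def vec_eq_iff forall_2 sum_2)
  \<comment> \<open>Expanded, this is the sum of the squared column norms minus twice the
    determinant, 1 + 1 - 2.\<close>
  have "(Q$1$1 - Q$2$2)\<^sup>2 + (Q$1$2 + Q$2$1)\<^sup>2 = 0"
    using det cols by (simp add: power2_eq_square algebra_simps)
  then have eq: "Q$2$2 = Q$1$1" "Q$1$2 = - Q$2$1" by (auto simp: sum_power2_eq_zero_iff)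
  obtain \<alpha> where "Q$1$1 = cos \<alpha>" "Q$2$1 = sin \<alpha>"
    using sincos_total_2pi[of "Q$1$1" "Q$2$1"] cols(1) by (auto simp: power2_eq_square)
  then have "Q = rot \<alpha>" using eq by (simp add: rot_def vec_eq_iff forall_2 vector_2)
  then show thesis by (rule that)
qed

lemma rigid_motion_iff: "rigid_motion f \<longleftrightarrow> (\<exists>\<alpha> b. f = (\<lambda>x. rot \<alpha> *v x + b))"
  unfolding rigid_motion_def by (metis rotation_matrix_2D rotation_matrix_rot)

text \<open>The difference set contains a translate of \<open>M\<close>. With the flat case below,
  the value at 0 decides whether a body has interior points, so a body with the same excluded area
  as \<open>M\<close> has interior too.\<close>

lemma excluded_area_zero_pos:
  assumes "convex_body M" "interior M \<noteq> {}"
  shows "excluded_area M 0 > 0"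
proof -
  obtain x where x: "x \<in> interior M" using assms(2) by blast
  then have "x \<in> M" using interior_subset by blast
  then have "(+) (- x) ` M \<subseteq> rot_difference M 0"
    unfolding rot_difference_alt by force
  moreover have "\<not> negligible M"
    using open_not_negligible[OF open_interior assms(2)] negligible_subset[OF _ interior_subset] by blast
  then have "\<not> negligible ((+) (- x) ` M)"
    using negligible_translation_rev by blast
  ultimately have "\<not> negligible (rot_difference M 0)"
    using negligible_subset by blast
  then have "measure lebesgue (rot_difference M 0) \<noteq> 0"
    using convex_body_measurable[OF convex_body_rot_difference[OF assms(1)]] negligible_iff_measure by blast
  then show ?thesis unfolding excluded_area_eq by (simp add: less_le)
qed

lemma excluded_area_zero_flat:
  assumes "convex_body M" "interior M = {}"
  shows "excluded_area M 0 = 0"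
proof -
  obtain a b where ab: "a \<noteq> 0" "M \<subseteq> {x. a \<bullet> x = b}"
    using empty_interior_subset_hyperplane[of M] assms by (auto simp: convex_body_def)
  then have "a \<bullet> (x - y) = 0" if "x \<in> M" "y \<in> M" for x y
    using that by (auto simp: inner_diff_right subset_iff)
  then have "rot_difference M 0 \<subseteq> {x. a \<bullet> x = 0}"
    unfolding rot_difference_alt by auto
  then have "negligible (rot_difference M 0)"
    using ab(1) negligible_hyperplane negligible_subset by blast
  then show ?thesis unfolding excluded_area_eq by (rule negligible_imp_measure0)
qed

text \<open>Twice this coefficient is the mean of the width h(t) + h(t + \<pi>), nonnegative by the
  second-difference inequality with d = \<pi>/2. It makes the constant coefficient recoverable from
  its modulus.\<close>

lemma fourier_coeff_zero_nonneg:
  assumes "convex_body M"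
  shows "Re (fourier_coeff (support_fun M) 0) \<ge> 0"
proof -
  let ?h = "support_fun M"
  have c: "continuous_on UNIV ?h" by (rule continuous_on_support_fun[OF assms])
  have c': "continuous_on UNIV (\<lambda>t. ?h (t + pi))"
    by (rule continuous_on_compose2[OF c]) (auto intro!: continuous_intros)
  have "fourier_coeff (\<lambda>t. ?h t + ?h (t + pi)) 0 = fourier_coeff ?h 0 + cis (of_int 0 * pi) * fourier_coeff ?h 0"
    by (subst fourier_coeff_add[OF c c'], subst fourier_coeff_shift[OF c]) simp_all
  moreover have "fourier_coeff (\<lambda>t. ?h t + ?h (t + pi)) 0 = of_real (integral {-pi..pi} (\<lambda>t. ?h t + ?h (t + pi)) / (2 * pi))"
  proof -
    have "((\<lambda>t. complex_of_real (?h t + ?h (t + pi))) has_integral of_real (integral {-pi..pi} (\<lambda>t. ?h t + ?h (t + pi)))) {-pi..pi}"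
      by (intro has_integral_of_real integrable_integral integrable_continuous_interval continuous_on_add
          continuous_on_subset[OF c] continuous_on_subset[OF c']) auto
    then show ?thesis by (simp add: fourier_coeff_cis integral_unique)
  qed
  moreover have "integral {-pi..pi} (\<lambda>t. ?h t + ?h (t + pi)) \<ge> 0"
  proof (intro integral_nonneg integrable_continuous_interval continuous_on_add
          continuous_on_subset[OF c] continuous_on_subset[OF c'])
    fix t
    have "t + pi = (t + pi / 2) + pi / 2" "t = (t + pi / 2) - pi / 2" by auto
    then show "0 \<le> ?h t + ?h (t + pi)"
      using support_fun_second_difference[OF assms, of "pi / 2" "t + pi / 2"] by (simp add: add.commute)
  qed auto
  ultimately have "2 * fourier_coeff ?h 0 = of_real (integral {-pi..pi} (\<lambda>t. ?h t + ?h (t + pi)) / (2 * pi))"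
    by simp
  then have "2 * Re (fourier_coeff ?h 0) = integral {-pi..pi} (\<lambda>t. ?h t + ?h (t + pi)) / (2 * pi)"
    by (metis Re_complex_of_real Re_divide_numeral mult_2 plus_complex.sel(1))
  also have "\<dots> \<ge> 0" using \<open>integral _ _ \<ge> 0\<close> by simp
  finally show ?thesis by simp
qed

lemma convex_body_eqI_fourier:
  assumes "convex_body M" "convex_body M'"
    and "\<And>n. n \<ge> 0 \<Longrightarrow> fourier_coeff (support_fun M) n = fourier_coeff (support_fun M') n"
  shows "M = M'"
proof -
  obtain R where R: "\<And>x. x \<in> M \<Longrightarrow> norm x \<le> R" using convex_body_norm_bound assms(1) by blast
  obtain R' where R': "\<And>x. x \<in> M' \<Longrightarrow> norm x \<le> R'" using convex_body_norm_bound assms(2) by blast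
  have "fourier_coeff (support_fun M) n = fourier_coeff (support_fun M') n" for n
  proof (cases "n \<ge> 0")
    case False
    then have "fourier_coeff (support_fun M) (- (- n)) = fourier_coeff (support_fun M') (- (- n))"
      unfolding fourier_coeff_uminus[of _ "- n"] using assms(3)[of "- n"] by simp
    then show ?thesis by simp
  qed (rule assms)
  note eq = this
  have "support_fun M = support_fun M'"
    by (rule fourier_coeff_inj[OF continuous_on_support_fun[OF assms(1)] support_fun_diff_le[OF assms(1) R]
        continuous_on_support_fun[OF assms(2)] support_fun_diff_le[OF assms(2) R'] eq])
  then show ?thesis using support_fun_inj assms by blast
qed

lemma congruent_of_excluded_area_eq:
  assumes M: "convex_body M" "interior M \<noteq> {}" and M': "convex_body M'"
    and E: "excluded_area M = excluded_area M'"
    and single: "\<not> (\<exists>n1 n2 :: int. n1 > n2 \<and> n2 \<ge> 2 \<and>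
        fourier_coeff (support_fun M) n1 \<noteq> 0 \<and> fourier_coeff (support_fun M) n2 \<noteq> 0)"
  shows "\<exists>f. rigid_motion f \<and> M' = f ` M"
proof -
  define c where "c = fourier_coeff (support_fun M)"
  define c' where "c' = fourier_coeff (support_fun M')"
  have "interior M' \<noteq> {}"
    using excluded_area_zero_pos[OF M] excluded_area_zero_flat[OF M'] E by auto
  then have norm: "cmod (c n) = cmod (c' n)" if "n \<noteq> 1" "n \<noteq> - 1" for n
    using excluded_area_eq_iff[OF M M'] E that unfolding c_def c'_def by blast
  have c0: "c 0 = of_real (Re (c 0))" "Re (c 0) \<ge> 0"
    unfolding c_def by (rule fourier_coeff_zero_real fourier_coeff_zero_nonneg[OF M(1)])+
  have c0': "c' 0 = of_real (Re (c' 0))" "Re (c' 0) \<ge> 0"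
    unfolding c'_def by (rule fourier_coeff_zero_real fourier_coeff_zero_nonneg[OF M'])+
  have "cmod (c 0) = Re (c 0)" "cmod (c' 0) = Re (c' 0)"
    using c0 c0' by (metis norm_of_real abs_of_nonneg)+
  then have zero: "c' 0 = c 0" using norm[of 0] c0 c0' by simp
  obtain \<alpha> where \<alpha>: "\<And>n. n \<ge> 2 \<Longrightarrow> c' n = cis (- (of_int n * \<alpha>)) * c n"
  proof (cases "\<exists>m\<ge>2. c m \<noteq> 0")
    case True
    then obtain m where m: "m \<ge> 2" "c m \<noteq> 0" by blast
    then have "cmod (c m) = cmod (c' m)" using norm[of m] by simp
    moreover have "cmod (c m) \<noteq> 0" using m by simp
    ultimately have "cmod (c' m / c m) = 1" by (simp only: norm_divide) simp
    then obtain \<beta> where "c' m / c m = cis \<beta>"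
      by (metis cis_conv_exp complex_norm_eq_1_exp)
    then have \<beta>: "c' m = cis \<beta> * c m" using m by (simp add: field_simps)
    \<comment> \<open>Rotation by \<alpha> multiplies the coefficient of index m by e^(-i m
      \<alpha>), so this angle produces the phase e^(i \<beta>); the other coefficients of index at
      least 2 vanish.\<close>
    show thesis
    proof (rule that[of "- \<beta> / of_int m"])
      fix n :: int assume n: "n \<ge> 2"
      show "c' n = cis (- (of_int n * (- \<beta> / of_int m))) * c n"
      proof (cases "n = m")
        case True
        then show ?thesis using \<beta> m by simp
      next
        case False
        then have "c n = 0" using single m n unfolding c_def by (meson linorder_neqE)
        then show ?thesis using norm[of n] n by simp
      qed
    qed
  next
    case False
    have "c' n = 0 \<and> c n = 0" if "n \<ge> 2" for n
      using False norm[of n] that by simp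
    then show thesis by (intro that[of 0]) simp
  qed
  \<comment> \<open>The discrepancy of the first-order coefficient that remains after the rotation;
    \<open>b\<close> is the translation whose coefficient at n = 1 is \<open>z\<close>.\<close>
  define z where "z = c' 1 - cis (- \<alpha>) * c 1"
  define b :: "real^2" where "b = vector [2 * Re z, - 2 * Im z]"
  have "Complex (b$1 / 2) (- b$2 / 2) = z" by (simp add: b_def vector_2 complex_eq_iff)
  have "M' = (\<lambda>x. rot \<alpha> *v x + b) ` M"
  proof (rule convex_body_eqI_fourier[OF M' convex_body_affine_image[OF M(1)]])
    fix n :: int assume "n \<ge> 0"
    then consider "n = 0" | "n = 1" | "n \<ge> 2" by linarith
    then show "fourier_coeff (support_fun M') n = fourier_coeff (support_fun ((\<lambda>x. rot \<alpha> *v x + b) ` M)) n"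
      unfolding fourier_coeff_affine_image[OF M(1)] c_def[symmetric] c'_def[symmetric]
    proof cases
      case 2
      then show "c' n = cis (- (of_int n * \<alpha>)) * c n + (if n = 1 then Complex (b$1 / 2) (- b$2 / 2) else 0)
          + (if n = - 1 then Complex (b$1 / 2) (b$2 / 2) else 0)"
        unfolding \<open>Complex (b$1 / 2) (- b$2 / 2) = z\<close> by (simp add: z_def)
    qed (use zero \<alpha> in auto)
  qed
  then show ?thesis using rigid_motion_iff by blast
qed

section \<open>Bodies with C2 boundary\<close>

lemma quadratic_taylor_bound:
  fixes f f1 f2 :: "real \<Rightarrow> real"
  assumes "\<And>x. (f has_real_derivative f1 x) (at x)" "\<And>x. (f1 has_real_derivative f2 x) (at x)"
    and "\<And>x. \<bar>x\<bar> \<le> \<bar>s\<bar> \<Longrightarrow> \<bar>f2 x\<bar> \<le> B"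
  shows "\<bar>f s - f 0 - s * f1 0\<bar> \<le> B * s\<^sup>2 / 2"
proof -
  define D where "D k = (if k = 0 then f else if k = 1 then f1 else f2)" for k :: nat
  have "\<exists>x. \<bar>x\<bar> \<le> \<bar>s\<bar> \<and> f s = (\<Sum>m<2. D m 0 / fact m * s ^ m) + D 2 x / fact 2 * s ^ 2"
    by (rule Maclaurin_bi_le) (use assms in \<open>auto simp: D_def less_2_cases_iff\<close>)
  then obtain x where x: "\<bar>x\<bar> \<le> \<bar>s\<bar>" "f s = f 0 + f1 0 * s + f2 x / 2 * s\<^sup>2"
    by (auto simp: D_def numeral_2_eq_2)
  have "\<bar>f2 x\<bar> * s\<^sup>2 \<le> B * s\<^sup>2"
    using assms(3)[OF x(1)] by (intro mult_right_mono) auto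
  then show ?thesis by (simp add: x(2) abs_mult)
qed

text \<open>The derivative cos x - 1/2 of the difference is nonnegative on [0, 1] because 1 <
  \<pi>/3.\<close>

lemma half_le_sin: "0 \<le> d \<Longrightarrow> d \<le> 1 \<Longrightarrow> d / 2 \<le> sin d" for d :: real
proof -
  assume d: "0 \<le> d" "d \<le> 1"
  have "sin 0 - 0 / 2 \<le> sin d - d / 2"
  proof (rule DERIV_nonneg_imp_nondecreasing[OF d(1)])
    fix x assume x: "0 \<le> x" "x \<le> d"
    then have "cos (pi / 3) \<le> cos x"
      using d pi_gt3 by (intro cos_monotone_0_pi_le) auto
    then show "\<exists>y. ((\<lambda>d. sin d - d / 2) has_real_derivative y) (at x) \<and> 0 \<le> y"
      by (intro exI[of _ "cos x - 1 / 2"]) (auto intro!: derivative_eq_intros simp: cos_60)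
  qed
  then show ?thesis by simp
qed

lemma norm_sq_frame:
  "(norm x)\<^sup>2 = (unit_dir t \<bullet> x)\<^sup>2 + (unit_dir (t + pi / 2) \<bullet> x)\<^sup>2" for x :: "real^2"
proof -
  have "(unit_dir t \<bullet> x)\<^sup>2 + (unit_dir (t + pi / 2) \<bullet> x)\<^sup>2 = ((x$1)\<^sup>2 + (x$2)\<^sup>2) * ((sin t)\<^sup>2 + (cos t)\<^sup>2)"
    unfolding inner_unit_dir sin_add cos_add sin_pi_half cos_pi_half by algebra
  also have "\<dots> = (norm x)\<^sup>2"
    by (simp add: norm_vec_def L2_set_def sum_2)
  finally show ?thesis by simp
qed

lemma support_point_frontier:
  assumes "convex_body M" "x \<in> M" "support_fun M t = unit_dir t \<bullet> x"
  shows "x \<in> frontier M"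
proof -
  have "x \<notin> interior M"
  proof
    assume "x \<in> interior M"
    then obtain e where e: "e > 0" "ball x e \<subseteq> M" by (auto simp: mem_interior)
    have "x + (e / 2) *\<^sub>R unit_dir t \<in> M"
      using e by (intro subsetD[OF e(2)]) (simp add: dist_norm)
    then have "unit_dir t \<bullet> (x + (e / 2) *\<^sub>R unit_dir t) \<le> unit_dir t \<bullet> x"
      using support_fun_upper[OF assms(1)] assms(3) by metis
    then show False using e(1) by (simp add: inner_add_right dot_square_norm)
  qed
  moreover have "closed M" using assms(1) by (simp add: convex_body_def compact_imp_closed)
  ultimately show ?thesis using assms(2) by (simp add: frontier_def)
qed

text \<open>A simple path takes different values at 0 and 1/2, and strict convexity puts the
  midpoint of these two boundary points in the interior.\<close>

lemma C2_plus_interior: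
  assumes "C2_plus_body M"
  shows "interior M \<noteq> {}"
proof -
  obtain g where g: "simple_path g" "path_image g = frontier M"
    using assms by (auto simp: C2_plus_body_def C2_boundary_nonvanishing_curvature_def)
  have "loop_free g" using g(1) by (simp add: simple_path_def)
  from this[unfolded loop_free_def, rule_format, of 0 "1 / 2"] have "g 0 \<noteq> g (1 / 2)" by auto
  moreover have "frontier M \<subseteq> M"
    using assms by (simp add: C2_plus_body_def convex_body_def compact_imp_closed frontier_subset_closed)
  then have "g 0 \<in> M" "g (1 / 2) \<in> M"
    using g(2) by (auto simp: path_image_def)
  ultimately show ?thesis
    using assms midpoint_in_open_segment[of "g 0" "g (1 / 2)"] unfolding C2_plus_body_def strictly_convex_def by blast
qed

text \<open>This is \<open>h + h'' \<ge> \<epsilon>\<close> in integrated form. Testing \<open>h(t \<plusminus> d)\<close> with the boundary points at parameter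
  \<open>\<tau> \<plusminus> c d\<close>, where \<open>g \<tau>\<close> is the contact point for \<open>t\<close>, gives it without differentiating \<open>h\<close>.\<close>

lemma C2_plus_second_difference:
  assumes "C2_plus_body M"
  obtains \<epsilon> where "\<epsilon> > 0"
    "\<And>t d. 0 < d \<Longrightarrow> d \<le> 1 \<Longrightarrow> support_fun M (t + d) + support_fun M (t - d) - 2 * cos d * support_fun M t \<ge> \<epsilon> * d\<^sup>2"
proof -
  obtain g g1 g2 :: "real \<Rightarrow> real^2" where g: "\<And>t. (g has_vector_derivative g1 t) (at t)"
    "\<And>t. (g1 has_vector_derivative g2 t) (at t)" "continuous_on UNIV g2" "\<And>t. g (t + 1) = g t"
    "path_image g = frontier M" "\<And>t. g1 t \<noteq> 0"
    using assms unfolding C2_plus_body_def C2_boundary_nonvanishing_curvature_def by blast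
  have M: "convex_body M" using assms by (simp add: C2_plus_body_def)
  interpret g: periodic_fun_simple' g by unfold_locales (rule g(4))
  have g_in: "g s \<in> M" for s
  proof -
    have "g s = g (frac s + of_int \<lfloor>s\<rfloor>)" by (simp add: frac_def)
    also have "\<dots> = g (frac s)" by (rule g.plus_of_int)
    also have "\<dots> \<in> path_image g" by (auto simp: path_image_def frac_ge_0 less_imp_le[OF frac_lt_1])
    also have "\<dots> \<subseteq> M"
      using M unfolding g(5) by (simp add: convex_body_def compact_imp_closed frontier_subset_closed)
    finally show ?thesis .
  qed
  have "continuous_on UNIV g1"
    using has_vector_derivative_continuous[OF g(2)] by (simp add: continuous_on_eq_continuous_at)
  then have "continuous_on {0..1} (\<lambda>s. norm (g1 s))"
    by (intro continuous_intros) (auto intro: continuous_on_subset)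
  then obtain s0 where s0: "s0 \<in> {0..1}" "\<And>s. s \<in> {0..1} \<Longrightarrow> norm (g1 s0) \<le> norm (g1 s)"
    using continuous_attains_inf[of "{0..1::real}" "\<lambda>s. norm (g1 s)"] by auto
  define m where "m = norm (g1 s0)"
  have m: "m > 0" "\<And>s. s \<in> {0..1} \<Longrightarrow> m \<le> norm (g1 s)"
    using s0 g(6) by (auto simp: m_def)
  \<comment> \<open>The contact parameter lies in [0, 1] and is moved by at most 1, so [-1, 2]
    covers all parameters that occur.\<close>
  have "compact (g2 ` {-1..2})"
    using g(3) by (intro compact_continuous_image) (auto intro: continuous_on_subset)
  then obtain B0 where B0: "\<And>s. s \<in> {-1..2} \<Longrightarrow> norm (g2 s) \<le> B0"
    by (meson compact_imp_bounded bounded_iff imageI)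
  \<comment> \<open>The maximum with \<open>m\<close> ensures \<open>c \<le> 1\<close>
    below.\<close>
  define B where "B = max B0 m"
  have B: "B > 0" "m \<le> B" "\<And>s. s \<in> {-1..2} \<Longrightarrow> norm (g2 s) \<le> B"
    using m B0 by (auto simp: B_def le_max_iff_disj)
  \<comment> \<open>Makes the quadratic error a fraction of the linear gain: with |\<eta>| = c d one
    has B \<eta>^2 = c m d^2 / 4, while the tangential gain is at least 2 c d m.\<close>
  define c where "c = m / (4 * B)"
  have c: "c > 0" "c \<le> 1" using m B by (auto simp: c_def)
  show thesis
  proof (rule that[of "c * m / 4"])
    show "c * m / 4 > 0" using c m by simp
  next
    fix t d :: real assume d: "0 < d" "d \<le> 1"
    define h where "h = support_fun M"
    obtain x where x: "x \<in> M" "h t = unit_dir t \<bullet> x"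
      using support_fun_attained[OF M] unfolding h_def by blast
    then have "x \<in> path_image g" using support_point_frontier[OF M] by (simp add: h_def g(5))
    then obtain \<tau> where \<tau>: "\<tau> \<in> {0..1}" "x = g \<tau>" by (auto simp: path_image_def)
    define u where "u = unit_dir t"
    define v where "v = unit_dir (t + pi / 2)"
    have der: "((\<lambda>s. w \<bullet> g (\<tau> + s)) has_real_derivative w \<bullet> g1 (\<tau> + s)) (at s)"
      "((\<lambda>s. w \<bullet> g1 (\<tau> + s)) has_real_derivative w \<bullet> g2 (\<tau> + s)) (at s)" for w s
    proof -
      have shift: "((\<lambda>s. w \<bullet> G (\<tau> + s)) has_real_derivative w \<bullet> G') (at s)"
        if "(G has_vector_derivative G') (at (\<tau> + s))" for G :: "real \<Rightarrow> real^2" and G'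
      proof -
        have "(G \<circ> (\<lambda>s. \<tau> + s) has_vector_derivative 1 *\<^sub>R G') (at s)"
          using that by (intro vector_diff_chain_at) (auto intro!: derivative_eq_intros)
        then have "((\<lambda>s. w \<bullet> G (\<tau> + s)) has_vector_derivative w \<bullet> G') (at s)"
          using bounded_linear.has_vector_derivative[OF bounded_linear_inner_right] by (fastforce simp: o_def)
        then show ?thesis by (simp add: has_real_derivative_iff_has_vector_derivative)
      qed
      show "((\<lambda>s. w \<bullet> g (\<tau> + s)) has_real_derivative w \<bullet> g1 (\<tau> + s)) (at s)"
        "((\<lambda>s. w \<bullet> g1 (\<tau> + s)) has_real_derivative w \<bullet> g2 (\<tau> + s)) (at s)"
        using shift g(1,2) by blast+
    qed
    have bound: "\<bar>w \<bullet> g (\<tau> + s) - w \<bullet> g \<tau> - s * (w \<bullet> g1 \<tau>)\<bar> \<le> B * s\<^sup>2 / 2"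
      if "norm w = 1" "\<bar>s\<bar> \<le> 1" for w s
    proof -
      have "\<bar>w \<bullet> g2 (\<tau> + y)\<bar> \<le> B" if "\<bar>y\<bar> \<le> \<bar>s\<bar>" for y
      proof -
        have "\<bar>w \<bullet> g2 (\<tau> + y)\<bar> \<le> norm w * norm (g2 (\<tau> + y))" by (rule Cauchy_Schwarz_ineq2)
        also have "\<dots> \<le> B" using that \<open>norm w = 1\<close> \<open>\<bar>s\<bar> \<le> 1\<close> \<tau>(1) by (auto intro!: B(3))
        finally show ?thesis .
      qed
      from quadratic_taylor_bound[OF der(1)[of w] der(2)[of w] this] show ?thesis by simp
    qed
    have u_max: "u \<bullet> g s \<le> u \<bullet> g \<tau>" for s
    proof -
      have "u \<bullet> g s \<le> h t" unfolding h_def u_def by (rule support_fun_upper[OF M g_in])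
      then show ?thesis by (simp add: x(2) \<tau>(2) u_def)
    qed
    \<comment> \<open>The contact point maximises the height in direction \<open>u\<close>, so the
      tangent there is orthogonal to \<open>u\<close> and has its full length in direction
      \<open>v\<close>.\<close>
    have "u \<bullet> g1 (\<tau> + 0) = 0"
    proof (rule DERIV_local_max[OF der(1), of 1])
      show "\<forall>y. \<bar>0 - y\<bar> < 1 \<longrightarrow> u \<bullet> g (\<tau> + y) \<le> u \<bullet> g (\<tau> + 0)"
        using u_max by simp
    qed simp
    then have u_orth: "u \<bullet> g1 \<tau> = 0" by simp
    define P where "P = v \<bullet> g1 \<tau>"
    have "(norm (g1 \<tau>))\<^sup>2 = P\<^sup>2"
      using norm_sq_frame[of "g1 \<tau>" t] u_orth by (simp add: P_def u_def v_def)
    then have "norm (g1 \<tau>) = \<bar>P\<bar>" by (metis norm_ge_zero power2_abs power2_eq_imp_eq abs_ge_zero)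
    then have P: "\<bar>P\<bar> \<ge> m" using m(2)[OF \<tau>(1)] by simp
    \<comment> \<open>The sign of \<open>P\<close> moves the parameter so that the component along
      \<open>v\<close> increases, whatever the orientation of the curve.\<close>
    define \<eta> where "\<eta> = c * d * sgn P"
    have "P \<noteq> 0" using P m by auto
    then have \<eta>: "\<bar>\<eta>\<bar> = c * d" "\<eta> * P = c * d * \<bar>P\<bar>"
      using c d by (auto simp: \<eta>_def abs_mult abs_sgn_eq sgn_mult_self_eq mult.assoc) (simp add: sgn_real_def)
    have \<eta>1: "\<bar>\<eta>\<bar> \<le> 1" "\<bar>- \<eta>\<bar> \<le> 1" using \<eta>(1) c d by (auto intro: mult_le_one)
    have sq: "B * \<eta>\<^sup>2 = c * m * d\<^sup>2 / 4"
    proof -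
      have "B * \<eta>\<^sup>2 = B * (c * d)\<^sup>2" by (metis \<eta>(1) power2_abs)
      also have "\<dots> = c * d\<^sup>2 * (B * c)" by (simp add: power2_eq_square)
      also have "B * c = m / 4" using B by (simp add: c_def)
      finally show ?thesis by simp
    qed
    have nu: "norm u = 1" "norm v = 1" by (simp_all add: u_def v_def)
    have \<phi>: "u \<bullet> g (\<tau> + \<eta>) + u \<bullet> g (\<tau> + - \<eta>) - 2 * (u \<bullet> g \<tau>) \<ge> - (B * \<eta>\<^sup>2)"
      "u \<bullet> g (\<tau> + \<eta>) + u \<bullet> g (\<tau> + - \<eta>) - 2 * (u \<bullet> g \<tau>) \<le> 0"
    proof -
      show "u \<bullet> g (\<tau> + \<eta>) + u \<bullet> g (\<tau> + - \<eta>) - 2 * (u \<bullet> g \<tau>) \<ge> - (B * \<eta>\<^sup>2)"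
        using bound[OF nu(1) \<eta>1(1)] bound[OF nu(1) \<eta>1(2)]
        unfolding u_orth power2_minus mult_zero_right by linarith
      from u_max[of "\<tau> + \<eta>"] u_max[of "\<tau> + - \<eta>"]
      show "u \<bullet> g (\<tau> + \<eta>) + u \<bullet> g (\<tau> + - \<eta>) - 2 * (u \<bullet> g \<tau>) \<le> 0" by simp
    qed
    have \<psi>: "v \<bullet> g (\<tau> + \<eta>) - v \<bullet> g (\<tau> + - \<eta>) \<ge> 2 * (\<eta> * P) - B * \<eta>\<^sup>2"
      using bound[OF nu(2) \<eta>1(1)] bound[OF nu(2) \<eta>1(2)]
      unfolding P_def power2_minus mult_minus_left by linarith
    have \<eta>P: "\<eta> * P \<ge> c * d * m" using \<eta>(2) P c d by (simp add: mult_left_mono)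
    have dd: "c * m * d\<^sup>2 \<le> c * d * m"
      using c d m mult_left_mono[of d 1 "c * m * d"] by (simp add: power2_eq_square mult_ac)
    have "h (t + d) \<ge> unit_dir (t + d) \<bullet> g (\<tau> + \<eta>)" "h (t - d) \<ge> unit_dir (t + - d) \<bullet> g (\<tau> + - \<eta>)"
      unfolding h_def using support_fun_upper[OF M g_in] by simp_all
    then have "h (t + d) + h (t - d) - 2 * cos d * h t
        \<ge> cos d * (u \<bullet> g (\<tau> + \<eta>) + u \<bullet> g (\<tau> + - \<eta>) - 2 * (u \<bullet> g \<tau>)) + sin d * (v \<bullet> g (\<tau> + \<eta>) - v \<bullet> g (\<tau> + - \<eta>))"
      unfolding unit_dir_add[of t d] unit_dir_add[of t "- d"] u_def[symmetric] v_def[symmetric] x(2) \<tau>(2)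
      by (simp add: inner_add_left algebra_simps)
    moreover have "cos d * (u \<bullet> g (\<tau> + \<eta>) + u \<bullet> g (\<tau> + - \<eta>) - 2 * (u \<bullet> g \<tau>)) \<ge> - (c * m * d\<^sup>2 / 4)"
    proof -
      have "1 * (u \<bullet> g (\<tau> + \<eta>) + u \<bullet> g (\<tau> + - \<eta>) - 2 * (u \<bullet> g \<tau>)) \<le> cos d * (u \<bullet> g (\<tau> + \<eta>) + u \<bullet> g (\<tau> + - \<eta>) - 2 * (u \<bullet> g \<tau>))"
        using \<phi>(2) by (intro mult_right_mono_neg) auto
      then show ?thesis using \<phi>(1) unfolding sq by simp
    qed
    moreover have "sin d * (v \<bullet> g (\<tau> + \<eta>) - v \<bullet> g (\<tau> + - \<eta>)) \<ge> c * m * d\<^sup>2 / 2"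
    proof -
      have "c * d * m \<le> v \<bullet> g (\<tau> + \<eta>) - v \<bullet> g (\<tau> + - \<eta>)"
        using \<psi> \<eta>P dd mult_pos_pos[OF mult_pos_pos[OF c(1) d(1)] m(1)] unfolding sq by linarith
      then have "d / 2 * (c * d * m) \<le> sin d * (v \<bullet> g (\<tau> + \<eta>) - v \<bullet> g (\<tau> + - \<eta>))"
        using half_le_sin[of d] d c m by (intro mult_mono) auto
      then show ?thesis by (simp add: power2_eq_square mult_ac)
    qed
    \<comment> \<open>The gain c m d^2 / 2 in direction \<open>v\<close> outweighs the loss c m d^2
      / 4 in direction \<open>u\<close>.\<close>
    ultimately show "support_fun M (t + d) + support_fun M (t - d) - 2 * cos d * support_fun M t \<ge> c * m / 4 * d\<^sup>2"
      unfolding h_def[symmetric] by simp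
  qed
qed

section \<open>Construction of the twin body\<close>

lemma one_minus_cos_le: "2 * (1 - cos x) \<le> x\<^sup>2" for x :: real
proof -
  have "\<bar>cos x - cos 0 - x * (- sin 0)\<bar> \<le> 1 * x\<^sup>2 / 2"
    by (rule quadratic_taylor_bound[of cos "\<lambda>x. - sin x" "\<lambda>x. - cos x"])
      (auto intro!: derivative_eq_intros)
  then show ?thesis by simp
qed

text \<open>The quantity inside the modulus is the factor by which the second difference acts on a
  wave of frequency n. Being of order d^2, it lets a wave of small amplitude be absorbed by the
  lower bound \<epsilon> d^2 for the body.\<close>

lemma abs_cos_mult_diff_le:
  "\<bar>2 * (cos (of_int n * d) - cos d)\<bar> \<le> (of_int n ^ 2 + 1) * d\<^sup>2" for d :: real
proof -
  have "2 * (1 - cos (of_int n * d)) \<le> of_int n ^ 2 * d\<^sup>2" "2 * (1 - cos d) \<le> d\<^sup>2"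
    using one_minus_cos_le[of "of_int n * d"] one_minus_cos_le[of d] by (simp_all only: power_mult_distrib)
  moreover have "cos (of_int n * d) \<le> 1" "cos d \<le> 1" "of_int n ^ 2 * d\<^sup>2 \<ge> 0" "d\<^sup>2 \<ge> 0"
    by simp_all
  ultimately show ?thesis
    unfolding distrib_right right_diff_distrib mult_1 by (intro abs_leI) linarith+
qed

lemma excluded_area_twin:
  assumes M: "C2_plus_body M" and n: "n1 > n2" "n2 \<ge> 2"
    and nz: "fourier_coeff (support_fun M) n1 \<noteq> 0" "fourier_coeff (support_fun M) n2 \<noteq> 0"
  shows "\<exists>M'. convex_body M' \<and> \<not> (\<exists>f. rigid_motion f \<and> M' = f ` M) \<and> excluded_area M = excluded_area M'"
proof -
  define c where "c = fourier_coeff (support_fun M)"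
  have Mc: "convex_body M" using M by (simp add: C2_plus_body_def)
  have Mi: "interior M \<noteq> {}" by (rule C2_plus_interior[OF M])
  obtain \<epsilon> where \<epsilon>: "\<epsilon> > 0" "\<And>t d. 0 < d \<Longrightarrow> d \<le> 1 \<Longrightarrow>
      support_fun M (t + d) + support_fun M (t - d) - 2 * cos d * support_fun M t \<ge> \<epsilon> * d\<^sup>2"
    using C2_plus_second_difference[OF M] by blast
  obtain x0 r where x0: "r > 0" "cball x0 r \<subseteq> M"
    using Mi by (metis ex_in_conv mem_interior_cball)
  obtain R where R: "R > 0" "\<And>x. x \<in> M \<Longrightarrow> norm x \<le> R" using convex_body_norm_bound[OF Mc] by blast
  \<comment> \<open>Placing an interior point at the origin bounds the function below by
    \<open>r\<close>; \<open>support_fun_wulff\<close> asks for such a positive bound.\<close>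
  define h where "h t = support_fun M t - unit_dir t \<bullet> x0" for t
  have h_ge: "h t \<ge> r" for t
  proof -
    have "unit_dir t \<bullet> (x0 + r *\<^sub>R unit_dir t) \<le> support_fun M t"
      using x0 by (intro support_fun_upper[OF Mc] subsetD[OF x0(2)]) (simp add: dist_norm)
    then show ?thesis by (simp add: h_def inner_add_right dot_square_norm)
  qed
  have h_le: "h t \<le> R + norm x0" for t
  proof -
    obtain x where x: "x \<in> M" "support_fun M t = unit_dir t \<bullet> x"
      using support_fun_attained[OF Mc] by blast
    have "h t \<le> norm (x - x0)"
      using norm_cauchy_schwarz[of "unit_dir t" "x - x0"] by (simp add: h_def x inner_diff_right)
    then show ?thesis using R(2)[OF x(1)] norm_triangle_ineq4[of x x0] by linarith
  qed
  have h_diff: "h (t + d) + h (t - d) - 2 * cos d * h t \<ge> \<epsilon> * d\<^sup>2" if "0 < d" "d \<le> 1" for t d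
  proof -
    have "unit_dir (t + d) \<bullet> x0 + unit_dir (t - d) \<bullet> x0 = 2 * cos d * (unit_dir t \<bullet> x0)"
      unfolding inner_add_left[symmetric] unit_dir_second_difference by simp
    then show ?thesis using \<epsilon>(2)[OF that, of t] by (simp add: h_def right_diff_distrib)
  qed
  define K where "K = cmod (c n1) * (of_int n1 ^ 2 + 1)"
  have n1: "real_of_int n1 ^ 2 \<ge> 0" by simp
  have K: "K > 0" using nz by (simp add: K_def c_def add_nonneg_pos)
  \<comment> \<open>The bound \<pi> / n2 keeps n2 \<delta> in (0, \<pi>], so that e^(i n2 \<delta>)
    is not 1. The other two keep the perturbed function at least r / 2 and its second difference
    positive for small d.\<close>
  define \<delta> where "\<delta> = min (pi / of_int n2) (min (r / (4 * K)) (\<epsilon> / (4 * K)))"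
  have \<delta>: "\<delta> > 0" "\<delta> \<le> pi / of_int n2" "K * \<delta> \<le> r / 4" "K * \<delta> \<le> \<epsilon> / 4"
  proof -
    show "\<delta> > 0" using n x0 \<epsilon> K by (simp add: \<delta>_def)
    show "\<delta> \<le> pi / of_int n2" by (simp add: \<delta>_def)
    have "\<delta> \<le> r / (4 * K)" "\<delta> \<le> \<epsilon> / (4 * K)" by (simp_all add: \<delta>_def)
    then show "K * \<delta> \<le> r / 4" "K * \<delta> \<le> \<epsilon> / 4" using K by (simp_all add: field_simps)
  qed
  \<comment> \<open>Adding \<open>a\<close> turns the coefficient of index n1 into e^(i \<delta>)
    times itself, with the same modulus.\<close>
  define a where "a = (cis \<delta> - 1) * c n1"
  have "cmod (cis \<delta> - 1) \<le> \<delta>"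
  proof -
    have "(cmod (cis \<delta> - 1))\<^sup>2 = 2 * (1 - cos \<delta>)"
      unfolding cmod_power2 using sin_cos_squared_add[of \<delta>] by (simp add: power2_eq_square algebra_simps)
    also have "\<dots> \<le> \<delta>\<^sup>2" by (rule one_minus_cos_le)
    finally show ?thesis using \<delta>(1) by (simp add: power2_le_iff_abs_le)
  qed
  then have a_le: "cmod a * (of_int n1 ^ 2 + 1) \<le> K * \<delta>"
    unfolding a_def K_def norm_mult
    using mult_right_mono[of "cmod (cis \<delta> - 1)" \<delta> "cmod (c n1) * (of_int n1 ^ 2 + 1)"] n1 by (simp add: mult_ac)
  have a_le': "cmod a \<le> K * \<delta>"
  proof -
    have "cmod a * 1 \<le> cmod a * (of_int n1 ^ 2 + 1)" using n1 by (intro mult_left_mono) auto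
    then show ?thesis using a_le by simp
  qed
  define q where "q t = 2 * Re (a * cis (of_int n1 * t))" for t
  have q_abs: "\<bar>q t\<bar> \<le> 2 * cmod a" for t
    using abs_Re_le_cmod[of "a * cis (of_int n1 * t)"] by (simp add: q_def norm_mult)
  have q_diff: "q (t + d) + q (t - d) - 2 * cos d * q t \<ge> - (\<epsilon> / 2 * d\<^sup>2)" for t d
  proof -
    have cis: "cis (of_int n1 * (t + d)) = cis (of_int n1 * t) * cis (of_int n1 * d)"
        "cis (of_int n1 * (t - d)) = cis (of_int n1 * t) * cis (- (of_int n1 * d))"
      by (simp_all add: cis_mult algebra_simps)
    have "q (t + d) + q (t - d) - 2 * cos d * q t = q t * (2 * (cos (of_int n1 * d) - cos d))"
      unfolding q_def cis by (simp add: algebra_simps)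
    moreover have "\<bar>q t * (2 * (cos (of_int n1 * d) - cos d))\<bar> \<le> (2 * cmod a) * ((of_int n1 ^ 2 + 1) * d\<^sup>2)"
      unfolding abs_mult[of "q t"] using abs_cos_mult_diff_le[of n1 d]
      by (intro mult_mono q_abs) auto
    moreover have "(2 * cmod a) * ((of_int n1 ^ 2 + 1) * d\<^sup>2) \<le> \<epsilon> / 2 * d\<^sup>2"
    proof -
      have "(2 * cmod a) * ((of_int n1 ^ 2 + 1) * d\<^sup>2) = cmod a * (of_int n1 ^ 2 + 1) * (2 * d\<^sup>2)"
        by (simp only: mult_ac)
      also have "\<dots> \<le> \<epsilon> / 4 * (2 * d\<^sup>2)"
        using a_le \<delta>(4) by (intro mult_right_mono) auto
      finally show ?thesis by simp
    qed
    ultimately show ?thesis by linarith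
  qed
  define f where "f t = h t + q t" for t
  have h_cont: "continuous_on UNIV h"
    unfolding h_def by (intro continuous_intros continuous_on_support_fun[OF Mc])
  have q_cont: "continuous_on UNIV q" unfolding q_def by (intro continuous_intros)
  have f_cont: "continuous_on UNIV f"
    unfolding f_def by (intro continuous_on_add h_cont q_cont)
  have f_per: "f (t + 2 * pi) = f t" for t
  proof -
    have "cis (of_int n1 * (t + 2 * pi)) = cis (of_int n1 * t) * cis (2 * pi * of_int n1)"
      by (simp add: cis_mult algebra_simps)
    also have "cis (2 * pi * of_int n1) = 1" by (rule cis_multiple_2pi) simp
    finally show ?thesis by (simp add: f_def h_def q_def)
  qed
  have f_diff: "\<exists>d. 0 < d \<and> d < e \<and> f (t + d) + f (t - d) > 2 * cos d * f t" if "e > 0" for t e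
  proof -
    define d where "d = min (e / 2) 1"
    have d: "0 < d" "d < e" "d \<le> 1" using that by (auto simp: d_def)
    have "\<epsilon> / 2 * d\<^sup>2 > 0" using \<epsilon>(1) d by simp
    then have "f (t + d) + f (t - d) > 2 * cos d * f t"
      using h_diff[OF d(1,3), of t] q_diff[of d t] unfolding f_def by (simp add: algebra_simps)
    then show ?thesis using d by blast
  qed
  have f_ge: "r / 2 \<le> f t" for t
    using h_ge[of t] q_abs[of t] a_le' \<delta>(3) unfolding f_def by linarith
  have f_le: "f t \<le> R + norm x0 + r / 2" for t
    using h_le[of t] q_abs[of t] a_le' \<delta>(3) unfolding f_def by linarith
  note body = support_fun_wulff[OF f_cont f_per f_diff _ f_ge f_le]
  define M' where "M' = wulff f"
  have M': "convex_body M'" "support_fun M' = f" "interior M' \<noteq> {}"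
    unfolding M'_def using body x0(1) by auto
  have coeff: "fourier_coeff (support_fun M') n = c n + ((if n = n1 then a else 0) + (if n = - n1 then cnj a else 0))"
    if "n \<noteq> 1" "n \<noteq> - 1" for n
  proof -
    have "h = (\<lambda>t. support_fun M t + unit_dir t \<bullet> (- x0))" by (auto simp: h_def)
    then have "fourier_coeff h n = c n + fourier_coeff (\<lambda>t. unit_dir t \<bullet> (- x0)) n"
      unfolding c_def by (simp only:) (intro fourier_coeff_add continuous_on_support_fun[OF Mc] continuous_intros)
    also have "\<dots> = c n" unfolding fourier_coeff_unit_dir_inner using that by simp
    finally have h: "fourier_coeff h n = c n" .
    have "fourier_coeff f n = fourier_coeff h n + fourier_coeff q n"
      unfolding f_def[abs_def] by (rule fourier_coeff_add[OF h_cont q_cont])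
    also have "fourier_coeff q n = (if n = n1 then a else 0) + (if n = - n1 then cnj a else 0)"
      unfolding q_def[abs_def] by (rule fourier_coeff_trig_monomial)
    finally show ?thesis by (simp only: M'(2) h)
  qed
  have n1_coeff: "fourier_coeff (support_fun M') n1 = cis \<delta> * c n1"
    using coeff[of n1] n by (simp add: a_def algebra_simps)
  have "cmod (fourier_coeff (support_fun M) n) = cmod (fourier_coeff (support_fun M') n)" if "n \<noteq> 1" "n \<noteq> - 1" for n
  proof -
    consider "n = n1" | "n = - n1" | "n \<noteq> n1" "n \<noteq> - n1" by blast
    then show ?thesis
    proof cases
      case 1
      then show ?thesis by (simp add: n1_coeff norm_mult c_def)
    next
      case 2
      then show ?thesis by (simp add: fourier_coeff_uminus n1_coeff norm_mult c_def)
    next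
      case 3
      then show ?thesis using coeff[OF that] by (simp add: c_def)
    qed
  qed
  then have "excluded_area M = excluded_area M'"
    using excluded_area_eq_iff[OF Mc Mi M'(1,3)] by blast
  moreover have "\<not> (\<exists>f. rigid_motion f \<and> M' = f ` M)"
  proof
    assume "\<exists>f. rigid_motion f \<and> M' = f ` M"
    then obtain \<alpha> b where "M' = (\<lambda>x. rot \<alpha> *v x + b) ` M" unfolding rigid_motion_iff by blast
    then have coeff': "fourier_coeff (support_fun M') k = cis (- (of_int k * \<alpha>)) * c k" if "k \<noteq> 1" "k \<noteq> - 1" for k
      using fourier_coeff_affine_image[OF Mc, of \<alpha> b k] that by (simp add: c_def)
    have "cis (- (of_int n2 * \<alpha>)) * c n2 = 1 * c n2"
      using coeff[of n2] coeff'[of n2] n by simp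
    then have 2: "cis (- (of_int n2 * \<alpha>)) = 1" using nz(2) by (simp add: c_def)
    have "cis (- (of_int n1 * \<alpha>)) * c n1 = cis \<delta> * c n1"
      using n1_coeff coeff'[of n1] n by simp
    then have 1: "cis (- (of_int n1 * \<alpha>)) = cis \<delta>" using nz(1) by (simp add: c_def)
    \<comment> \<open>The number e^(-i n1 n2 \<alpha>) is both the n2-th power of e^(-i n1 \<alpha>)
      = e^(i \<delta>) and the n1-th power of e^(-i n2 \<alpha>) = 1.\<close>
    have "cis (of_nat (nat n2) * \<delta>) = cis \<delta> ^ nat n2" by (simp add: Complex.DeMoivre)
    also have "\<dots> = cis (- (of_int n2 * \<alpha>)) ^ nat n1"
      unfolding 1[symmetric] Complex.DeMoivre using n by (simp add: mult_ac)
    also have "\<dots> = 1" by (simp add: 2)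
    finally have cis_eq: "cis (of_int n2 * \<delta>) = 1" using n by simp
    have "0 < of_int n2 * \<delta>" "of_int n2 * \<delta> \<le> pi"
      using n \<delta>(1,2) by (auto simp: field_simps)
    then have "cos (of_int n2 * \<delta>) < cos 0" by (intro cos_monotone_0_pi) auto
    moreover have "cos (of_int n2 * \<delta>) = 1" using arg_cong[OF cis_eq, of Re] by simp
    ultimately show False by simp
  qed
  ultimately show ?thesis using M'(1) by blast
qed

theorem theorem2p1:
  shows "(\<forall>M M' :: (real^2) set. C2_plus_body M \<longrightarrow> C2_plus_body M' \<longrightarrow>
            (excluded_area M = excluded_area M' \<longleftrightarrow>
             (\<forall>n :: int. n \<noteq> 1 \<longrightarrow> n \<noteq> - 1 \<longrightarrow>
                cmod (fourier_coeff (support_fun M) n) =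
                cmod (fourier_coeff (support_fun M') n))))
       \<and> (\<forall>M :: (real^2) set. C2_plus_body M \<longrightarrow>
            ((\<exists>M'. convex_body M' \<and>
                   \<not> (\<exists>f. rigid_motion f \<and> M' = f ` M) \<and>
                   excluded_area M = excluded_area M') \<longleftrightarrow>
             (\<exists>n1 n2 :: int. n1 > n2 \<and> n2 \<ge> 2 \<and>
                fourier_coeff (support_fun M) n1 \<noteq> 0 \<and>
                fourier_coeff (support_fun M) n2 \<noteq> 0)))"
proof (intro conjI allI impI)
  fix M M' :: "(real^2) set"
  assume "C2_plus_body M" "C2_plus_body M'"
  then show "excluded_area M = excluded_area M' \<longleftrightarrow>
             (\<forall>n :: int. n \<noteq> 1 \<longrightarrow> n \<noteq> - 1 \<longrightarrow>
                cmod (fourier_coeff (support_fun M) n) =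
                cmod (fourier_coeff (support_fun M') n))"
    by (intro excluded_area_eq_iff C2_plus_interior) (simp_all add: C2_plus_body_def)
next
  fix M :: "(real^2) set"
  assume M: "C2_plus_body M"
  then have "convex_body M" "interior M \<noteq> {}"
    using C2_plus_interior by (auto simp only: C2_plus_body_def)
  then show "(\<exists>M'. convex_body M' \<and> \<not> (\<exists>f. rigid_motion f \<and> M' = f ` M) \<and> excluded_area M = excluded_area M') \<longleftrightarrow>
             (\<exists>n1 n2 :: int. n1 > n2 \<and> n2 \<ge> 2 \<and>
                fourier_coeff (support_fun M) n1 \<noteq> 0 \<and> fourier_coeff (support_fun M) n2 \<noteq> 0)"
    using congruent_of_excluded_area_eq[of M] excluded_area_twin[OF M] by blast
qed

end
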